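(* Let $\Bbbk$ be a field of characteristic $0$. With the algebra homomorphisms $\rho:U(W_+)\to \Bbbk(X)[t;\tau^*]$, $\phi:U(W_+)\to S$ and $\lambda_a:U(W_+)\to R$ ($a\in\Bbbk$) as in the context, we have $$\ker\rho=\ker\phi=\bigcap_{a\in\Bbbk}\ker\lambda_a.$$
   Context: The positive Witt algebra $W_+$ is the Lie algebra over $\Bbbk$ with basis $\{e_n\}_{n\geq 1}$ and bracket $[e_n,e_m]=(m-n)e_{n+m}$; $U(W_+)$ is its universal enveloping algebra; it is generated as an algebra by $e_1,e_2$. $S$ is the $\Bbbk$-algebra generated by $u,v,w$ subject to $uv-vu-v^2=0$, $uw-wu-vw=0$, $vw-wv=0$. $R$ is the $\Bbbk$-algebra generated by $u,v$ subject to $uv-vu-v^2=0$. $\phi: U(W_+)\to S$ is the (well-defined) algebra homomorphism with $\phi(e_n)=(u-(n-1)w)v^{n-1}$ for all $n\ge1$. For $a\in\Bbbk$, $\lambda_a: U(W_+)\to R$ is the (well-defined) algebra homomorphism with $\lambda_a(e_n)=(u-(n-1)av)v^{n-1}$ for all $n\ge 1$. Let $\mathbb P^3=\mathbb P^3_\Bbbk$ have coordinates $w,x,y,z$, and let $X=V(xz-y^2)\subseteq\mathbb P^3$. Define an automorphism $\tau$ of $X$ by $\tau([w:x:y:z])=[w-2x+2z:z:-y-2z:x+4y+4z]$. Let $\tau^*$ be the pullback on the function field $\Bbbk(X)$, $g^\tau:=\tau^*g=g\circ\tau$. Let $\Bbbk(X)[t;\tau^*]$ be the skew polynomial ring with $tg=g^\tau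 t$ for $g\in\Bbbk(X)$. Let $f=\dfrac{w+12x+22y+8z}{12x+6y}\in\Bbbk(X)$. Then $\rho:U(W_+)\to\Bbbk(X)[t;\tau^*]$ is the algebra homomorphism determined by $\rho(e_1)=t$, $\rho(e_2)=ft^2$ (it is known that this is well-defined). *)

theory Defs
  imports
    Complex_Main
    "HOL-Library.Poly_Mapping"
    "HOL-Computational_Algebra.Fraction_Field"
begin

section \<open>Sums over finitely supported functions\<close>

definition psum :: "('a \<Rightarrow> 'b::zero \<Rightarrow> 'c::comm_monoid_add) \<Rightarrow> ('a \<Rightarrow>\<^sub>0 'b) \<Rightarrow> 'c" where
  "psum h p = (\<Sum>i\<in>Poly_Mapping.keys p. h i (Poly_Mapping.lookup p i))"

lemma psum_superset:
  assumes "finite A" "Poly_Mapping.keys p \<subseteq> A" "\<And>i. h i 0 = 0"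
  shows "psum h p = (\<Sum>i\<in>A. h i (Poly_Mapping.lookup p i))"
  unfolding psum_def using assms by (intro sum.mono_neutral_left) (auto simp: in_keys_iff)

lemma psum_zero [simp]: "psum h 0 = 0"
  by (simp add: psum_def)

lemma psum_single:
  assumes "\<And>i. h i 0 = 0"
  shows "psum h (Poly_Mapping.single i a) = h i a"
  using assms by (subst psum_superset[of "{i}"]) auto

lemma psum_add:
  assumes z: "\<And>i. h i 0 = 0" and a: "\<And>i x y. h i (x + y) = h i x + h i y"
  shows "psum h (p + q) = psum h p + psum h q"
proof -
  let ?A = "Poly_Mapping.keys p \<union> Poly_Mapping.keys q"
  have "psum h (p + q) = (\<Sum>i\<in>?A. h i (Poly_Mapping.lookup (p + q) i))"
    by (rule psum_superset) (auto simp: z keys_add)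
  also have "\<dots> = (\<Sum>i\<in>?A. h i (Poly_Mapping.lookup p i)) + (\<Sum>i\<in>?A. h i (Poly_Mapping.lookup q i))"
    by (simp add: lookup_add a sum.distrib)
  also have "(\<Sum>i\<in>?A. h i (Poly_Mapping.lookup p i)) = psum h p"
    by (rule psum_superset[symmetric]) (auto simp: z)
  also have "(\<Sum>i\<in>?A. h i (Poly_Mapping.lookup q i)) = psum h q"
    by (rule psum_superset[symmetric]) (auto simp: z)
  finally show ?thesis .
qed

lemma psum_distrib: "psum (\<lambda>i x. h i x + k i x) p = psum h p + psum k p"
  by (simp add: psum_def sum.distrib)

lemma poly_mapping_add_induct [case_names zero single add]:
  fixes p :: "'a \<Rightarrow>\<^sub>0 'b::monoid_add"
  assumes "P 0" "\<And>i a. P (Poly_Mapping.single i a)" "\<And>f g. P f \<Longrightarrow> P g \<Longrightarrow> P (f + g)"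
  shows "P p"
proof (induction p rule: update_induct)
  case const
  show ?case by (rule assms(1))
next
  case (update f a b)
  have "Poly_Mapping.update a b f = f + Poly_Mapping.single a b"
    using update(1)
    by (intro poly_mapping_eqI)
       (auto simp: lookup_update lookup_add lookup_single when_def in_keys_iff)
  with update(3) show ?case by (simp add: assms)
qed


section \<open>Algebra homomorphisms\<close>

text \<open>Associative unital algebras over a field are given by a \<open>ring_1\<close> type together with
  an explicit scalar multiplication.\<close>

definition algebra_hom ::
  "('k::field \<Rightarrow> 'a::ring_1 \<Rightarrow> 'a) \<Rightarrow> ('k \<Rightarrow> 'b::ring_1 \<Rightarrow> 'b) \<Rightarrow> ('a \<Rightarrow> 'b) \<Rightarrow> bool" where
  "algebra_hom s1 s2 h \<longleftrightarrow>
     Vector_Spaces.linear s1 s2 h \<and> h 1 = 1 \<and> (\<forall>x y. h (x * y) = h x * h y)"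

definition ker :: "('a \<Rightarrow> 'b::zero) \<Rightarrow> 'a set" where
  "ker h = {x. h x = 0}"


section \<open>Free algebras and two-sided ideals\<close>

datatype 'x free_monoid = Letters "'x list"

instantiation free_monoid :: (type) monoid_add
begin

definition zero_free_monoid :: "'a free_monoid" where
  "zero_free_monoid = Letters []"

fun plus_free_monoid :: "'a free_monoid \<Rightarrow> 'a free_monoid \<Rightarrow> 'a free_monoid" where
  "plus_free_monoid (Letters xs) (Letters ys) = Letters (xs @ ys)"

instance
proof
  fix a b c :: "'a free_monoid"
  show "a + b + c = a + (b + c)" by (cases a; cases b; cases c) simp
  show "0 + a = a" "a + 0 = a" by (cases a; simp add: zero_free_monoid_def)+
qed

end

lemma free_monoid_add_eq_0_iff: "(a::'a free_monoid) + b = 0 \<longleftrightarrow> a = 0 \<and> b = 0"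
  by (cases a; cases b) (simp add: zero_free_monoid_def)

type_synonym ('x, 'k) free_algebra = "'x free_monoid \<Rightarrow>\<^sub>0 'k"

definition gen :: "'x \<Rightarrow> ('x, 'k::field) free_algebra" where
  "gen x = Poly_Mapping.single (Letters [x]) 1"

definition fscale :: "'k::field \<Rightarrow> ('x, 'k) free_algebra \<Rightarrow> ('x, 'k) free_algebra" where
  "fscale c p = Poly_Mapping.single 0 c * p"

lemma lookup_mult_0:
  fixes p q :: "('x, 'k::field) free_algebra"
  shows "Poly_Mapping.lookup (p * q) 0 = Poly_Mapping.lookup p 0 * Poly_Mapping.lookup q 0"
proof (induction p rule: poly_mapping_add_induct)
  case (single i a)
  show ?case
  proof (induction q rule: poly_mapping_add_induct)
    case (single j b)
    show ?case
      by (auto simp: mult_single lookup_single when_def free_monoid_add_eq_0_iff)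
  qed (simp_all add: algebra_simps lookup_add)
qed (simp_all add: algebra_simps lookup_add)

lemma lookup_gen_0 [simp]: "Poly_Mapping.lookup (gen x) 0 = 0"
  by (simp add: gen_def lookup_single zero_free_monoid_def)

lemma single_0_central:
  fixes r :: "('x, 'k::field) free_algebra"
  shows "Poly_Mapping.single 0 c * r = r * Poly_Mapping.single 0 c"
  by (induction r rule: poly_mapping_add_induct) (simp_all add: mult_single algebra_simps)

lemma fscale_mult: "fscale c p * q = fscale c (p * q)" "p * fscale c q = fscale c (p * q)"
  unfolding fscale_def by (metis single_0_central mult.assoc)+

lemma vector_space_fscale: "vector_space fscale"
  by unfold_locales
     (simp_all add: fscale_def algebra_simps single_add mult_single single_one flip: mult.assoc)

inductive_set ideal_gen :: "'a::ring_1 set \<Rightarrow> 'a set" for G where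
  ideal_gen_0: "0 \<in> ideal_gen G"
| ideal_gen_gen: "g \<in> G \<Longrightarrow> x * g * y \<in> ideal_gen G"
| ideal_gen_add: "a \<in> ideal_gen G \<Longrightarrow> b \<in> ideal_gen G \<Longrightarrow> a + b \<in> ideal_gen G"

lemma ideal_gen_mult_left: "a \<in> ideal_gen G \<Longrightarrow> r * a \<in> ideal_gen G"
proof (induction rule: ideal_gen.induct)
  case (ideal_gen_gen g x y)
  then show ?case using ideal_gen.ideal_gen_gen[of g G "r * x" y] by (simp add: mult.assoc)
qed (auto intro: ideal_gen.intros simp: algebra_simps)

lemma ideal_gen_mult_right: "a \<in> ideal_gen G \<Longrightarrow> a * r \<in> ideal_gen G"
proof (induction rule: ideal_gen.induct)
  case (ideal_gen_gen g x y)
  then show ?case using ideal_gen.ideal_gen_gen[of g G x "y * r"] by (simp add: mult.assoc)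
qed (auto intro: ideal_gen.intros simp: algebra_simps)

lemma ideal_gen_uminus: "a \<in> ideal_gen G \<Longrightarrow> - a \<in> ideal_gen G"
  using ideal_gen_mult_left[of a G "-1"] by simp

definition ideal_cong :: "'a::ring_1 set \<Rightarrow> 'a \<Rightarrow> 'a \<Rightarrow> bool" where
  "ideal_cong G p q \<longleftrightarrow> p - q \<in> ideal_gen G"

lemma ideal_cong_refl: "ideal_cong G p p"
  by (simp add: ideal_cong_def ideal_gen_0)

lemma equivp_ideal_cong: "equivp (ideal_cong G)"
proof (rule equivpI)
  show "reflp (ideal_cong G)" by (simp add: reflp_def ideal_cong_refl)
  show "symp (ideal_cong G)"
    unfolding symp_def ideal_cong_def using ideal_gen_uminus by (metis minus_diff_eq)
  show "transp (ideal_cong G)"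
    unfolding transp_def ideal_cong_def using ideal_gen_add by (metis diff_add_cancel add_diff_eq)
qed

lemma ideal_cong_add:
  "ideal_cong G p q \<Longrightarrow> ideal_cong G p' q' \<Longrightarrow> ideal_cong G (p + p') (q + q')"
  unfolding ideal_cong_def using ideal_gen_add[of "p - q" G "p' - q'"] by (simp add: algebra_simps)

lemma ideal_cong_uminus: "ideal_cong G p q \<Longrightarrow> ideal_cong G (- p) (- q)"
  unfolding ideal_cong_def using ideal_gen_uminus[of "p - q" G] by (simp add: algebra_simps)

lemma ideal_cong_diff:
  "ideal_cong G p q \<Longrightarrow> ideal_cong G p' q' \<Longrightarrow> ideal_cong G (p - p') (q - q')"
  using ideal_cong_add[of G p q "- p'" "- q'"] ideal_cong_uminus by auto

lemma ideal_cong_mult: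
  "ideal_cong G p q \<Longrightarrow> ideal_cong G p' q' \<Longrightarrow> ideal_cong G (p * p') (q * q')"
  unfolding ideal_cong_def
  using ideal_gen_add[OF ideal_gen_mult_left[of "p' - q'" G p] ideal_gen_mult_right[of "p - q" G q']]
  by (simp add: algebra_simps)

lemma ideal_cong_fscale: "ideal_cong G p q \<Longrightarrow> ideal_cong G (fscale c p) (fscale c q)"
  unfolding fscale_def by (intro ideal_cong_mult ideal_cong_refl)

text \<open>Relations without constant term never generate the unit ideal.\<close>

lemma not_ideal_cong_0_1:
  fixes G :: "('x, 'k::field) free_algebra set"
  assumes "\<And>g. g \<in> G \<Longrightarrow> Poly_Mapping.lookup g 0 = 0"
  shows "\<not> ideal_cong G 0 1"
proof -
  have "Poly_Mapping.lookup a 0 = 0" if "a \<in> ideal_gen G" for a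
    using that by induction (auto simp: assms lookup_mult_0 lookup_add)
  then show ?thesis
    unfolding ideal_cong_def by (metis diff_0 lookup_one_zero lookup_uminus neg_equal_0_iff_equal zero_neq_one)
qed


section \<open>The positive Witt algebra and its universal enveloping algebra\<close>

typedef posnat = "{n::nat. n \<ge> 1}" morphisms nat_of_pos pos_of_nat
  by auto

instantiation posnat :: ab_semigroup_add
begin

definition plus_posnat :: "posnat \<Rightarrow> posnat \<Rightarrow> posnat" where
  "n + m = pos_of_nat (nat_of_pos n + nat_of_pos m)"

lemma nat_of_pos_add: "nat_of_pos (n + m) = nat_of_pos n + nat_of_pos m"
  using nat_of_pos[of n] by (simp add: plus_posnat_def pos_of_nat_inverse)

instance
  by standard (simp_all add: nat_of_pos_add flip: nat_of_pos_inject)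

end

text \<open>\<open>single n c\<close> stands for $c e_n$.\<close>

type_synonym 'k witt = "posnat \<Rightarrow>\<^sub>0 'k"

definition witt_e :: "nat \<Rightarrow> 'k::field witt" where
  "witt_e n = Poly_Mapping.single (pos_of_nat n) 1"

definition witt_scale :: "'k::field \<Rightarrow> 'k witt \<Rightarrow> 'k witt" where
  "witt_scale c p = Poly_Mapping.map ((*) c) p"

definition witt_bracket :: "'k::field witt \<Rightarrow> 'k witt \<Rightarrow> 'k witt" where
  "witt_bracket p q = psum (\<lambda>n a. psum (\<lambda>m b.
     Poly_Mapping.single (n + m)
       ((of_nat (nat_of_pos m) - of_nat (nat_of_pos n)) * (a * b))) q) p"

lemma lookup_witt_scale [simp]: "Poly_Mapping.lookup (witt_scale c p) n = c * Poly_Mapping.lookup p n"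
  by (auto simp: witt_scale_def map.rep_eq when_def in_keys_iff)

lemma vector_space_witt_scale: "vector_space witt_scale"
  by unfold_locales (auto intro!: poly_mapping_eqI simp: lookup_add algebra_simps)

lemma witt_scale_single [simp]:
  "witt_scale c (Poly_Mapping.single n a) = Poly_Mapping.single n (c * a)"
  by (rule poly_mapping_eqI) (simp add: lookup_single when_def)

lemma witt_scale_add: "witt_scale c (p + q) = witt_scale c p + witt_scale c q"
  by (rule poly_mapping_eqI) (simp add: lookup_add algebra_simps)

lemma witt_bracket_single:
  "witt_bracket (Poly_Mapping.single n a) (Poly_Mapping.single m b) =
   Poly_Mapping.single (n + m) ((of_nat (nat_of_pos m) - of_nat (nat_of_pos n)) * (a * b))"
  unfolding witt_bracket_def by (subst psum_single, simp add: psum_def)+ (simp add: psum_def)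

lemma witt_bracket_add_left: "witt_bracket (p + q) r = witt_bracket p r + witt_bracket q r"
  unfolding witt_bracket_def
  by (rule psum_add)
     (simp_all add: psum_def algebra_simps single_add single_diff sum.distrib sum_subtractf)

lemma witt_bracket_add_right: "witt_bracket p (q + r) = witt_bracket p q + witt_bracket p r"
proof -
  have "psum (\<lambda>m b. Poly_Mapping.single (n + m)
       ((of_nat (nat_of_pos m) - of_nat (nat_of_pos n)) * (a * b))) (q + r) =
     psum (\<lambda>m b. Poly_Mapping.single (n + m)
       ((of_nat (nat_of_pos m) - of_nat (nat_of_pos n)) * (a * b))) q +
     psum (\<lambda>m b. Poly_Mapping.single (n + m)
       ((of_nat (nat_of_pos m) - of_nat (nat_of_pos n)) * (a * b))) r" for n and a :: 'a
    by (rule psum_add) (simp_all add: algebra_simps flip: single_add)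
  then show ?thesis
    unfolding witt_bracket_def by (simp add: psum_distrib)
qed

lemma witt_bracket_0 [simp]: "witt_bracket 0 p = 0" "witt_bracket p 0 = 0"
  by (simp_all add: witt_bracket_def psum_def)

lemma witt_bracket_e:
  assumes "n \<ge> 1" "m \<ge> 1"
  shows "witt_bracket (witt_e n) (witt_e m) = witt_scale (of_nat m - of_nat n) (witt_e (n + m))"
proof -
  have "pos_of_nat n + pos_of_nat m = pos_of_nat (n + m)"
    using assms by (simp add: nat_of_pos_add pos_of_nat_inverse flip: nat_of_pos_inject)
  with assms show ?thesis
    by (simp add: witt_e_def witt_bracket_single pos_of_nat_inverse)
qed

locale lie_algebra = vector_space scale
  for scale :: "'k::field \<Rightarrow> 'l::ab_group_add \<Rightarrow> 'l" +
  fixes bracket :: "'l \<Rightarrow> 'l \<Rightarrow> 'l"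
  assumes bracket_add_left: "bracket (x + y) z = bracket x z + bracket y z"
    and bracket_add_right: "bracket z (x + y) = bracket z x + bracket z y"
    and bracket_scale_left: "bracket (scale c x) y = scale c (bracket x y)"
    and bracket_scale_right: "bracket x (scale c y) = scale c (bracket x y)"
    and bracket_self: "bracket x x = 0"
    and jacobi: "bracket x (bracket y z) + bracket y (bracket z x) + bracket z (bracket x y) = 0"

lemma witt_bracket_swap: "witt_bracket p q = - witt_bracket q p"
proof (induction p rule: poly_mapping_add_induct)
  case (single n a)
  show ?case
    by (induction q rule: poly_mapping_add_induct)
       (simp_all add: witt_bracket_single witt_bracket_add_left witt_bracket_add_right
          add.commute[of n] algebra_simps flip: single_uminus)
qed (simp_all add: witt_bracket_add_left witt_bracket_add_right)

lemma lie_algebra_witt: "lie_algebra witt_scale witt_bracket"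
proof -
  interpret vector_space witt_scale by (rule vector_space_witt_scale)
  show ?thesis
  proof
    fix x y z :: "'k::field witt" and c :: 'k
    show "witt_bracket (x + y) z = witt_bracket x z + witt_bracket y z"
      by (rule witt_bracket_add_left)
    show "witt_bracket z (x + y) = witt_bracket z x + witt_bracket z y"
      by (rule witt_bracket_add_right)
    show left: "witt_bracket (witt_scale c x) y = witt_scale c (witt_bracket x y)" for x y
    proof (induction x rule: poly_mapping_add_induct)
      case (single n a)
      show ?case
        by (induction y rule: poly_mapping_add_induct)
           (simp_all add: witt_bracket_single witt_bracket_add_right witt_scale_add algebra_simps)
    qed (simp_all add: witt_bracket_add_left witt_scale_add)
    show "witt_bracket x (witt_scale c y) = witt_scale c (witt_bracket x y)"
      using left[of y x] witt_bracket_swap[of x] scale_minus_right by metis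
    show "witt_bracket x x = 0"
    proof (induction x rule: poly_mapping_add_induct)
      case (add f g)
      then show ?case
        using witt_bracket_swap[of f g]
        by (simp add: witt_bracket_add_left witt_bracket_add_right)
    qed (simp_all add: witt_bracket_single)
    define J where "J x y z = witt_bracket x (witt_bracket y z) + witt_bracket y (witt_bracket z x)
        + witt_bracket z (witt_bracket x y)" for x y z :: "'k witt"
    have J_add: "J (f + g) y z = J f y z + J g y z" "J x (f + g) z = J x f z + J x g z"
      "J x y (f + g) = J x y f + J x y g" for f g x y z
      by (simp_all add: J_def witt_bracket_add_left witt_bracket_add_right add_ac)
    have J_0: "J 0 y z = 0" "J x 0 z = 0" "J x y 0 = 0" for x y z
      by (simp_all add: J_def)
    have "J x y z = 0"
    proof (induction x rule: poly_mapping_add_induct)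
      case x: (single n a)
      show ?case
      proof (induction y rule: poly_mapping_add_induct)
        case y: (single m b)
        show ?case
        proof (induction z rule: poly_mapping_add_induct)
          case z: (single l c)
          have "m + (l + n) = n + (m + l)" "l + (n + m) = n + (m + l)"
            by (simp_all add: ac_simps)
          then show ?case
            by (simp add: J_def witt_bracket_single nat_of_pos_add algebra_simps flip: single_add)
        qed (simp_all add: J_add J_0)
      qed (simp_all add: J_add J_0)
    qed (simp_all add: J_add J_0)
    then show "witt_bracket x (witt_bracket y z) + witt_bracket y (witt_bracket z x)
        + witt_bracket z (witt_bracket x y) = 0"
      by (simp add: J_def)
  qed
qed

text \<open>The tensor algebra of a vector space is the free algebra on its elements modulo
  linearity of the inclusion \<open>gen\<close> (the first two families of relations); the last family
  gives the enveloping algebra.\<close>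

definition enveloping_relations ::
  "('k::field \<Rightarrow> 'l::ab_group_add \<Rightarrow> 'l) \<Rightarrow> ('l \<Rightarrow> 'l \<Rightarrow> 'l) \<Rightarrow> ('l, 'k) free_algebra set" where
  "enveloping_relations scale bracket =
     {gen (x + y) - (gen x + gen y) | x y. True} \<union>
     {gen (scale c x) - fscale c (gen x) | c x. True} \<union>
     {gen x * gen y - gen y * gen x - gen (bracket x y) | x y. True}"

lemma enveloping_relations_lookup_0:
  "g \<in> enveloping_relations scale bracket \<Longrightarrow> Poly_Mapping.lookup g 0 = 0"
  by (auto simp: enveloping_relations_def lookup_minus lookup_add lookup_mult_0 fscale_def)

quotient_type (overloaded) 'k UW =
  "('k::field witt, 'k) free_algebra" / "ideal_cong (enveloping_relations witt_scale witt_bracket)"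
  by (rule equivp_ideal_cong)

instantiation UW :: (field) ring_1
begin
lift_definition zero_UW :: "'a UW" is 0 .
lift_definition one_UW :: "'a UW" is 1 .
lift_definition plus_UW :: "'a UW \<Rightarrow> 'a UW \<Rightarrow> 'a UW" is "(+)" by (rule ideal_cong_add)
lift_definition minus_UW :: "'a UW \<Rightarrow> 'a UW \<Rightarrow> 'a UW" is "(-)" by (rule ideal_cong_diff)
lift_definition uminus_UW :: "'a UW \<Rightarrow> 'a UW" is uminus by (rule ideal_cong_uminus)
lift_definition times_UW :: "'a UW \<Rightarrow> 'a UW \<Rightarrow> 'a UW" is "(*)" by (rule ideal_cong_mult)
instance
proof
  show "(0::'a UW) \<noteq> 1"
    by transfer (rule not_ideal_cong_0_1, rule enveloping_relations_lookup_0)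
qed (transfer; simp add: algebra_simps ideal_cong_refl)+
end

lift_definition UW_scale :: "'k::field \<Rightarrow> 'k UW \<Rightarrow> 'k UW" is fscale
  by (rule ideal_cong_fscale)

lemma vector_space_UW_scale: "vector_space UW_scale"
proof -
  interpret F: vector_space fscale by (rule vector_space_fscale)
  show ?thesis
    by unfold_locales (transfer; simp add: F.scale_right_distrib F.scale_left_distrib ideal_cong_refl)+
qed

definition UW_incl :: "'k::field witt \<Rightarrow> 'k UW" where
  "UW_incl x = abs_UW (gen x)"

definition UW_e :: "nat \<Rightarrow> 'k::field UW" where
  "UW_e n = UW_incl (witt_e n)"


section \<open>The algebras S and R\<close>

datatype gen_S = SU | SV | SW

definition relations_S :: "(gen_S, 'k::field) free_algebra set" where
  "relations_S =
     {gen SU * gen SV - gen SV * gen SU - gen SV ^ 2,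
      gen SU * gen SW - gen SW * gen SU - gen SV * gen SW,
      gen SV * gen SW - gen SW * gen SV}"

lemma relations_S_lookup_0: "g \<in> relations_S \<Longrightarrow> Poly_Mapping.lookup g 0 = 0"
  by (auto simp: relations_S_def lookup_minus lookup_mult_0 power2_eq_square)

quotient_type (overloaded) 'k alg_S = "(gen_S, 'k::field) free_algebra" / "ideal_cong relations_S"
  by (rule equivp_ideal_cong)

instantiation alg_S :: (field) ring_1
begin
lift_definition zero_alg_S :: "'a alg_S" is 0 .
lift_definition one_alg_S :: "'a alg_S" is 1 .
lift_definition plus_alg_S :: "'a alg_S \<Rightarrow> 'a alg_S \<Rightarrow> 'a alg_S" is "(+)" by (rule ideal_cong_add)
lift_definition minus_alg_S :: "'a alg_S \<Rightarrow> 'a alg_S \<Rightarrow> 'a alg_S" is "(-)" by (rule ideal_cong_diff)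
lift_definition uminus_alg_S :: "'a alg_S \<Rightarrow> 'a alg_S" is uminus by (rule ideal_cong_uminus)
lift_definition times_alg_S :: "'a alg_S \<Rightarrow> 'a alg_S \<Rightarrow> 'a alg_S" is "(*)" by (rule ideal_cong_mult)
instance
proof
  show "(0::'a alg_S) \<noteq> 1"
    by transfer (rule not_ideal_cong_0_1, rule relations_S_lookup_0)
qed (transfer; simp add: algebra_simps ideal_cong_refl)+
end

lift_definition S_scale :: "'k::field \<Rightarrow> 'k alg_S \<Rightarrow> 'k alg_S" is fscale
  by (rule ideal_cong_fscale)

lemma vector_space_S_scale: "vector_space S_scale"
proof -
  interpret F: vector_space fscale by (rule vector_space_fscale)
  show ?thesis
    by unfold_locales (transfer; simp add: F.scale_right_distrib F.scale_left_distrib ideal_cong_refl)+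
qed

lift_definition S_u :: "'k::field alg_S" is "gen SU" .
lift_definition S_v :: "'k::field alg_S" is "gen SV" .
lift_definition S_w :: "'k::field alg_S" is "gen SW" .

datatype gen_R = RU | RV

definition relations_R :: "(gen_R, 'k::field) free_algebra set" where
  "relations_R = {gen RU * gen RV - gen RV * gen RU - gen RV ^ 2}"

lemma relations_R_lookup_0: "g \<in> relations_R \<Longrightarrow> Poly_Mapping.lookup g 0 = 0"
  by (auto simp: relations_R_def lookup_minus lookup_mult_0 power2_eq_square)

quotient_type (overloaded) 'k alg_R = "(gen_R, 'k::field) free_algebra" / "ideal_cong relations_R"
  by (rule equivp_ideal_cong)

instantiation alg_R :: (field) ring_1
begin
lift_definition zero_alg_R :: "'a alg_R" is 0 .
lift_definition one_alg_R :: "'a alg_R" is 1 .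
lift_definition plus_alg_R :: "'a alg_R \<Rightarrow> 'a alg_R \<Rightarrow> 'a alg_R" is "(+)" by (rule ideal_cong_add)
lift_definition minus_alg_R :: "'a alg_R \<Rightarrow> 'a alg_R \<Rightarrow> 'a alg_R" is "(-)" by (rule ideal_cong_diff)
lift_definition uminus_alg_R :: "'a alg_R \<Rightarrow> 'a alg_R" is uminus by (rule ideal_cong_uminus)
lift_definition times_alg_R :: "'a alg_R \<Rightarrow> 'a alg_R \<Rightarrow> 'a alg_R" is "(*)" by (rule ideal_cong_mult)
instance
proof
  show "(0::'a alg_R) \<noteq> 1"
    by transfer (rule not_ideal_cong_0_1, rule relations_R_lookup_0)
qed (transfer; simp add: algebra_simps ideal_cong_refl)+
end

lift_definition R_scale :: "'k::field \<Rightarrow> 'k alg_R \<Rightarrow> 'k alg_R" is fscale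
  by (rule ideal_cong_fscale)

lemma vector_space_R_scale: "vector_space R_scale"
proof -
  interpret F: vector_space fscale by (rule vector_space_fscale)
  show ?thesis
    by unfold_locales (transfer; simp add: F.scale_right_distrib F.scale_left_distrib ideal_cong_refl)+
qed

lift_definition R_u :: "'k::field alg_R" is "gen RU" .
lift_definition R_v :: "'k::field alg_R" is "gen RV" .


section \<open>The function field of X and the pullback along tau\<close>

datatype coord = CW | CX | CY | CZ

lemma UNIV_coord: "UNIV = {CW, CX, CY, CZ}"
  using coord.exhaust by auto

instance coord :: finite
  by standard (simp add: UNIV_coord)

type_synonym 'k mpoly4 = "(coord \<Rightarrow>\<^sub>0 nat) \<Rightarrow>\<^sub>0 'k"

definition Var :: "coord \<Rightarrow> 'k::field mpoly4" where
  "Var i = Poly_Mapping.single (Poly_Mapping.single i 1) 1"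

definition Const :: "'k::field \<Rightarrow> 'k mpoly4" where
  "Const c = Poly_Mapping.single 0 c"

text \<open>\<open>peval \<iota> p F\<close> is the value of \<open>F\<close> at the quadruple \<open>p\<close>, coefficients being mapped
  by \<open>\<iota>\<close>.\<close>

definition peval ::
  "('k::field \<Rightarrow> 'b::comm_ring_1) \<Rightarrow> (coord \<Rightarrow> 'b) \<Rightarrow> 'k mpoly4 \<Rightarrow> 'b" where
  "peval \<iota> p F = psum (\<lambda>m a. \<iota> a * (\<Prod>i\<in>UNIV. p i ^ Poly_Mapping.lookup m i)) F"

definition scalar_hom :: "('k::field \<Rightarrow> 'b::comm_ring_1) \<Rightarrow> bool" where
  "scalar_hom \<iota> \<longleftrightarrow> \<iota> 0 = 0 \<and> \<iota> 1 = 1 \<and> (\<forall>a b. \<iota> (a + b) = \<iota> a + \<iota> b) \<and>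
     (\<forall>a b. \<iota> (a * b) = \<iota> a * \<iota> b)"

lemma scalar_hom_Const: "scalar_hom Const"
  by (simp add: scalar_hom_def Const_def single_one single_add mult_single)

lemma scalar_hom_id: "scalar_hom (\<lambda>x. x)"
  by (simp add: scalar_hom_def)

lemma
  assumes "scalar_hom \<iota>"
  shows peval_0 [simp]: "peval \<iota> p 0 = 0"
    and peval_single: "peval \<iota> p (Poly_Mapping.single m a) = \<iota> a * (\<Prod>i\<in>UNIV. p i ^ Poly_Mapping.lookup m i)"
    and peval_add: "peval \<iota> p (F + G) = peval \<iota> p F + peval \<iota> p G"
proof -
  show "peval \<iota> p 0 = 0" by (simp add: peval_def)
  show "peval \<iota> p (Poly_Mapping.single m a) = \<iota> a * (\<Prod>i\<in>UNIV. p i ^ Poly_Mapping.lookup m i)"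
    using assms unfolding peval_def by (subst psum_single) (simp_all add: scalar_hom_def)
  show "peval \<iota> p (F + G) = peval \<iota> p F + peval \<iota> p G"
    using assms unfolding peval_def by (intro psum_add) (simp_all add: scalar_hom_def distrib_right)
qed

lemma peval_Const: "scalar_hom \<iota> \<Longrightarrow> peval \<iota> p (Const c) = \<iota> c"
  by (simp add: Const_def peval_single)

lemma peval_Var: "scalar_hom \<iota> \<Longrightarrow> peval \<iota> p (Var i) = p i"
  by (cases i) (simp_all add: Var_def peval_single UNIV_coord scalar_hom_def lookup_single when_def)

lemma peval_1: "scalar_hom \<iota> \<Longrightarrow> peval \<iota> p 1 = 1"
  using peval_Const[of \<iota> p 1] by (simp add: Const_def single_one scalar_hom_def)

lemma peval_mult:
  assumes "scalar_hom \<iota>"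
  shows "peval \<iota> p (F * G) = peval \<iota> p F * peval \<iota> p G"
proof (induction F rule: poly_mapping_add_induct)
  case (single m a)
  show ?case
  proof (induction G rule: poly_mapping_add_induct)
    case (single n b)
    show ?case
      using assms
      by (simp add: mult_single peval_single scalar_hom_def lookup_add power_add prod.distrib mult_ac)
  qed (simp_all add: assms peval_add algebra_simps)
qed (simp_all add: assms peval_add algebra_simps)

lemma peval_uminus: "scalar_hom \<iota> \<Longrightarrow> peval \<iota> p (- F) = - peval \<iota> p F"
  using peval_add[of \<iota> p F "- F"] by (simp add: eq_neg_iff_add_eq_0 add.commute)

lemma peval_diff: "scalar_hom \<iota> \<Longrightarrow> peval \<iota> p (F - G) = peval \<iota> p F - peval \<iota> p G"
  using peval_add[of \<iota> p F "- G"] by (simp add: peval_uminus)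

lemma peval_power: "scalar_hom \<iota> \<Longrightarrow> peval \<iota> p (F ^ n) = peval \<iota> p F ^ n"
  by (induction n) (simp_all add: peval_1 peval_mult)

lemma peval_of_nat: "scalar_hom \<iota> \<Longrightarrow> peval \<iota> p (of_nat n) = of_nat n"
  by (induction n) (simp_all add: peval_1 peval_add)

lemma peval_numeral: "scalar_hom \<iota> \<Longrightarrow> peval \<iota> p (numeral n) = numeral n"
  using peval_of_nat[of \<iota> p "numeral n"] by simp

lemma peval_prod:
  assumes "scalar_hom \<iota>" "finite A"
  shows "peval \<iota> p (\<Prod>i\<in>A. f i) = (\<Prod>i\<in>A. peval \<iota> p (f i))"
  using assms(2) by induction (simp_all add: assms(1) peval_1 peval_mult)

lemma peval_comp:
  assumes "scalar_hom \<iota>"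
  shows "peval \<iota> q (peval Const p F) = peval \<iota> (\<lambda>i. peval \<iota> q (p i)) F"
proof (induction F rule: poly_mapping_add_induct)
  case (single m a)
  show ?case
    by (simp add: assms scalar_hom_Const peval_single peval_mult peval_Const peval_prod peval_power)
qed (simp_all add: assms scalar_hom_Const peval_add)

lemma prod_Var: "(\<Prod>i\<in>UNIV. Var i ^ Poly_Mapping.lookup m i) = Poly_Mapping.single m (1::'k::field)"
proof -
  have pw: "Var i ^ n = Poly_Mapping.single (Poly_Mapping.single i n) (1::'k)" for i n
    by (induction n) (simp_all add: Var_def mult_single flip: single_add)
  have "Poly_Mapping.single CW (Poly_Mapping.lookup m CW) +
        (Poly_Mapping.single CX (Poly_Mapping.lookup m CX) +
        (Poly_Mapping.single CY (Poly_Mapping.lookup m CY) +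
         Poly_Mapping.single CZ (Poly_Mapping.lookup m CZ))) = m"
  proof (rule poly_mapping_eqI)
    fix k show "Poly_Mapping.lookup (Poly_Mapping.single CW (Poly_Mapping.lookup m CW) +
        (Poly_Mapping.single CX (Poly_Mapping.lookup m CX) +
        (Poly_Mapping.single CY (Poly_Mapping.lookup m CY) +
         Poly_Mapping.single CZ (Poly_Mapping.lookup m CZ)))) k = Poly_Mapping.lookup m k"
      by (cases k) (simp_all add: lookup_add lookup_single when_def)
  qed
  then show ?thesis
    by (simp add: UNIV_coord pw mult_single)
qed

lemma peval_Var_id: "peval Const Var F = F"
proof (induction F rule: poly_mapping_add_induct)
  case (single m a)
  show ?case
    by (simp add: scalar_hom_Const peval_single prod_Var) (simp add: Const_def mult_single)
qed (simp_all add: scalar_hom_Const peval_add)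

definition quadric :: "'k::field mpoly4" where
  "quadric = Var CX * Var CZ - Var CY ^ 2"

text \<open>To see that the quadric is prime, we substitute $x = s^2$, $y = st$, $z = t^2$, which is
  the map \<open>push pexp\<close> below; its kernel is generated by the quadric.\<close>

definition push :: "('a \<Rightarrow> 'b) \<Rightarrow> ('a \<Rightarrow>\<^sub>0 'k::comm_ring_1) \<Rightarrow> ('b \<Rightarrow>\<^sub>0 'k)" where
  "push g = psum (\<lambda>m a. Poly_Mapping.single (g m) a)"

lemma push_0 [simp]: "push g 0 = 0"
  by (simp add: push_def)

lemma push_single [simp]: "push g (Poly_Mapping.single m a) = Poly_Mapping.single (g m) a"
  unfolding push_def by (rule psum_single) simp

lemma push_add: "push g (p + q) = push g p + push g q"
  unfolding push_def by (rule psum_add) (simp_all add: single_add)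

lemma push_mult:
  assumes "\<And>m n. g (m + n) = g m + g n"
  shows "push g (p * q) = push g p * push g q"
proof (induction p rule: poly_mapping_add_induct)
  case (single m a)
  show ?case
    by (induction q rule: poly_mapping_add_induct)
       (simp_all add: mult_single assms push_add algebra_simps)
qed (simp_all add: push_add algebra_simps)

lemma push_diff: "push g (p - q) = push g p - push g q"
  using push_add[of g "p - q" q] by (simp add: algebra_simps)

lemma push_uminus: "push g (- p) = - push g p"
  using push_diff[of g 0 p] by simp

definition pexp :: "(coord \<Rightarrow>\<^sub>0 nat) \<Rightarrow> (nat \<Rightarrow>\<^sub>0 nat)" where
  "pexp m = Poly_Mapping.single 0 (Poly_Mapping.lookup m CW)
     + Poly_Mapping.single 1 (2 * Poly_Mapping.lookup m CX + Poly_Mapping.lookup m CY)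
     + Poly_Mapping.single 2 (Poly_Mapping.lookup m CY + 2 * Poly_Mapping.lookup m CZ)"

definition pexp_inv :: "(nat \<Rightarrow>\<^sub>0 nat) \<Rightarrow> (coord \<Rightarrow>\<^sub>0 nat)" where
  "pexp_inv r = Poly_Mapping.single CW (Poly_Mapping.lookup r 0)
     + Poly_Mapping.single CX (Poly_Mapping.lookup r 1 div 2)
     + Poly_Mapping.single CY (Poly_Mapping.lookup r 1 mod 2)
     + Poly_Mapping.single CZ (Poly_Mapping.lookup r 2 div 2)"

lemma pexp_add: "pexp (m + n) = pexp m + pexp n"
  by (simp add: pexp_def lookup_add algebra_simps single_add)

lemma push_pexp_quadric: "push pexp quadric = (0 :: (nat \<Rightarrow>\<^sub>0 nat) \<Rightarrow>\<^sub>0 'k::field)"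
proof -
  have "pexp (Poly_Mapping.single CX 1) + pexp (Poly_Mapping.single CZ 1) =
        pexp (Poly_Mapping.single CY 1) + pexp (Poly_Mapping.single CY 1)"
    by (intro poly_mapping_eqI) (simp add: pexp_def lookup_single lookup_add when_def)
  then show ?thesis
    by (simp add: quadric_def Var_def push_diff push_mult pexp_add power2_eq_square mult_single)
qed

lemma quadric_dvd_normal_form:
  "quadric dvd Poly_Mapping.single m (c::'k::field) - Poly_Mapping.single (pexp_inv (pexp m)) c"
proof (induction "Poly_Mapping.lookup m CY" arbitrary: m rule: less_induct)
  case less
  show ?case
  proof (cases "Poly_Mapping.lookup m CY \<ge> 2")
    case False
    then have "Poly_Mapping.lookup m CY = 0 \<or> Poly_Mapping.lookup m CY = 1" by auto
    then have "pexp_inv (pexp m) = m"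
    proof (intro poly_mapping_eqI)
      fix k
      assume "Poly_Mapping.lookup m CY = 0 \<or> Poly_Mapping.lookup m CY = 1"
      then show "Poly_Mapping.lookup (pexp_inv (pexp m)) k = Poly_Mapping.lookup m k"
        by (elim disjE; cases k) (simp_all add: pexp_inv_def pexp_def lookup_add lookup_single)
    qed
    then show ?thesis by simp
  next
    case True
    define m0 where "m0 = m - Poly_Mapping.single CY 2"
    define m1 where "m1 = m0 + (Poly_Mapping.single CX 1 + Poly_Mapping.single CZ 1)"
    have m: "m = m0 + (Poly_Mapping.single CY 1 + Poly_Mapping.single CY 1)"
      unfolding m0_def using True
      by (intro poly_mapping_eqI, rename_tac k, case_tac k)
         (auto simp: lookup_add lookup_minus lookup_single when_def)
    have "Poly_Mapping.lookup m1 CY < Poly_Mapping.lookup m CY"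
      using True unfolding m1_def m0_def
      by (simp add: lookup_add lookup_minus lookup_single when_def)
    then have 1: "quadric dvd Poly_Mapping.single m1 c - Poly_Mapping.single (pexp_inv (pexp m1)) c"
      by (rule less)
    have 2: "pexp m1 = pexp m"
      unfolding m m1_def pexp_add
      by (intro poly_mapping_eqI) (simp add: pexp_def lookup_single lookup_add when_def)
    have "Poly_Mapping.single m c - Poly_Mapping.single m1 c = quadric * (- Poly_Mapping.single m0 c)"
      unfolding m m1_def quadric_def Var_def
      by (simp add: algebra_simps mult_single power2_eq_square)
    then have "quadric dvd Poly_Mapping.single m c - Poly_Mapping.single m1 c" by simp
    from dvd_add[OF this 1] show ?thesis by (simp add: 2)
  qed
qed

lemma quadric_dvd_iff: "quadric dvd F \<longleftrightarrow> push pexp (F::'k::field mpoly4) = 0"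
proof
  assume "quadric dvd F"
  then show "push pexp F = 0"
    by (auto elim!: dvdE simp: push_mult pexp_add push_pexp_quadric)
next
  assume "push pexp F = 0"
  moreover have "quadric dvd F - push pexp_inv (push pexp F)"
  proof (induction F rule: poly_mapping_add_induct)
    case (add f g)
    have "f + g - push pexp_inv (push pexp (f + g)) =
      (f - push pexp_inv (push pexp f)) + (g - push pexp_inv (push pexp g))"
      by (simp add: push_add)
    with add show ?case by (metis dvd_add)
  qed (simp_all add: quadric_dvd_normal_form)
  ultimately show "quadric dvd F" by simp
qed

text \<open>The homogeneous coordinate ring of X.\<close>

definition quadric_cong :: "'k::field mpoly4 \<Rightarrow> 'k mpoly4 \<Rightarrow> bool" where
  "quadric_cong F G \<longleftrightarrow> quadric dvd F - G"

lemma quadric_cong_iff: "quadric_cong F G \<longleftrightarrow> push pexp F = push pexp G"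
  by (simp add: quadric_cong_def quadric_dvd_iff push_diff)

quotient_type (overloaded) 'k coordX = "'k::field mpoly4" / quadric_cong
  by (rule equivpI) (auto simp: reflp_def symp_def transp_def quadric_cong_iff)

instantiation coordX :: (field) idom
begin
lift_definition zero_coordX :: "'a coordX" is 0 .
lift_definition one_coordX :: "'a coordX" is 1 .
lift_definition plus_coordX :: "'a coordX \<Rightarrow> 'a coordX \<Rightarrow> 'a coordX" is "(+)"
  by (simp add: quadric_cong_iff push_add)
lift_definition minus_coordX :: "'a coordX \<Rightarrow> 'a coordX \<Rightarrow> 'a coordX" is "(-)"
  by (simp add: quadric_cong_iff push_diff)
lift_definition uminus_coordX :: "'a coordX \<Rightarrow> 'a coordX" is uminus
  by (simp add: quadric_cong_iff push_uminus)
lift_definition times_coordX :: "'a coordX \<Rightarrow> 'a coordX \<Rightarrow> 'a coordX" is "(*)"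
  by (simp add: quadric_cong_iff push_mult pexp_add)
instance
proof
  fix a b :: "'a coordX"
  have "push pexp (1 :: 'a mpoly4) = 1"
    using push_single[of pexp 0 "1::'a"] by (simp add: pexp_def single_one)
  then show "(0::'a coordX) \<noteq> 1"
    by transfer (simp add: quadric_cong_iff)
  show "a \<noteq> 0 \<Longrightarrow> b \<noteq> 0 \<Longrightarrow> a * b \<noteq> 0"
    by transfer (simp add: quadric_cong_iff push_mult pexp_add)
qed (transfer; simp add: algebra_simps quadric_cong_iff)+
end

definition homogeneous :: "nat \<Rightarrow> 'k::field mpoly4 \<Rightarrow> bool" where
  "homogeneous d F \<longleftrightarrow> (\<forall>m\<in>Poly_Mapping.keys F. (\<Sum>i\<in>UNIV. Poly_Mapping.lookup m i) = d)"

lemma homogeneous_0: "homogeneous d 0"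
  by (simp add: homogeneous_def)

lemma homogeneous_Const: "homogeneous 0 (Const c)"
  by (simp add: homogeneous_def Const_def)

lemma homogeneous_1: "homogeneous 0 1"
  using homogeneous_Const[of 1] by (simp add: Const_def single_one)

lemma homogeneous_Var: "homogeneous 1 (Var i)"
  by (cases i) (simp_all add: homogeneous_def Var_def UNIV_coord lookup_single when_def)

lemma homogeneous_add: "homogeneous d F \<Longrightarrow> homogeneous d G \<Longrightarrow> homogeneous d (F + G)"
  unfolding homogeneous_def using keys_add[of F G] by (meson Un_iff subsetD)

lemma homogeneous_uminus: "homogeneous d F \<Longrightarrow> homogeneous d (- F)"
  unfolding homogeneous_def by (auto simp: in_keys_iff)

lemma homogeneous_diff: "homogeneous d F \<Longrightarrow> homogeneous d G \<Longrightarrow> homogeneous d (F - G)"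
  using homogeneous_add[of d F "- G"] by (simp add: homogeneous_uminus)

lemma homogeneous_mult: "homogeneous d F \<Longrightarrow> homogeneous d' G \<Longrightarrow> homogeneous (d + d') (F * G)"
  unfolding homogeneous_def using keys_mult[of F G] by (fastforce simp: lookup_add sum.distrib)

lemma homogeneous_power: "homogeneous d F \<Longrightarrow> homogeneous (n * d) (F ^ n)"
  by (induction n) (auto simp: homogeneous_1 dest: homogeneous_mult)

lemma homogeneous_of_nat_mult: "homogeneous d F \<Longrightarrow> homogeneous d (of_nat n * F)"
  by (induction n) (simp_all add: homogeneous_0 homogeneous_add distrib_right)

lemma homogeneous_numeral_mult: "homogeneous d F \<Longrightarrow> homogeneous d (numeral n * F)"
  using homogeneous_of_nat_mult[of d F "numeral n"] by simp

lemma homogeneous_prod_power: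
  assumes "\<And>i. homogeneous 1 (p i)"
  shows "finite A \<Longrightarrow> homogeneous (\<Sum>i\<in>A. n i) (\<Prod>i\<in>A. p i ^ n i)"
  by (induction rule: finite_induct)
     (use homogeneous_power[OF assms] in \<open>auto simp: homogeneous_1 intro!: homogeneous_mult\<close>)

lemma homogeneous_peval:
  assumes F: "homogeneous d F" and p: "\<And>i. homogeneous 1 (p i)"
  shows "homogeneous d (peval Const p (F :: 'k::field mpoly4))"
proof -
  have "homogeneous d (Const a * (\<Prod>i\<in>UNIV. p i ^ Poly_Mapping.lookup m i))"
    if "m \<in> Poly_Mapping.keys F" for a m
  proof -
    have "homogeneous d (\<Prod>i\<in>UNIV. p i ^ Poly_Mapping.lookup m i)"
      using homogeneous_prod_power[of p UNIV "Poly_Mapping.lookup m", OF p] F that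
      by (auto simp: homogeneous_def)
    from homogeneous_mult[OF homogeneous_Const this] show ?thesis by simp
  qed
  moreover have "homogeneous d (\<Sum>m\<in>A. h m)"
    if "\<And>m. m \<in> A \<Longrightarrow> homogeneous d (h m)" "finite A"
    for A :: "(coord \<Rightarrow>\<^sub>0 nat) set" and h :: "(coord \<Rightarrow>\<^sub>0 nat) \<Rightarrow> 'k::field mpoly4"
    using that(2,1) by induction (auto simp: homogeneous_0 homogeneous_add)
  ultimately show ?thesis
    unfolding peval_def psum_def by simp
qed

definition clsX :: "'k::field mpoly4 \<Rightarrow> 'k coordX" where
  "clsX F = abs_coordX F"

lemma clsX_hom [simp]:
  "clsX 0 = 0" "clsX 1 = 1" "clsX (F + G) = clsX F + clsX G" "clsX (F - G) = clsX F - clsX G"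
  "clsX (- F) = - clsX F" "clsX (F * G) = clsX F * clsX G"
  by (simp_all add: clsX_def zero_coordX.abs_eq one_coordX.abs_eq plus_coordX.abs_eq
      minus_coordX.abs_eq uminus_coordX.abs_eq times_coordX.abs_eq)

lemma clsX_eq_0_iff: "clsX F = 0 \<longleftrightarrow> quadric dvd F"
  by (simp add: clsX_def zero_coordX.abs_eq coordX.abs_eq_iff quadric_cong_def)

text \<open>The function field: fractions of homogeneous elements of equal degree.\<close>

definition homogeneous_fraction :: "'k::field coordX fract \<Rightarrow> bool" where
  "homogeneous_fraction g \<longleftrightarrow> (\<exists>d F G. homogeneous d F \<and> homogeneous d G \<and>
     \<not> quadric dvd G \<and> g = Fract (clsX F) (clsX G))"

lemma homogeneous_fractionI:
  "homogeneous d F \<Longrightarrow> homogeneous d G \<Longrightarrow> \<not> quadric dvd G \<Longrightarrow>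
     homogeneous_fraction (Fract (clsX F) (clsX G))"
  unfolding homogeneous_fraction_def by blast

lemma quadric_prime: "quadric dvd F * G \<Longrightarrow> quadric dvd F \<or> quadric dvd (G::'k::field mpoly4)"
  unfolding clsX_eq_0_iff[symmetric] by simp

lemma quadric_not_dvd_1: "\<not> quadric dvd (1::'k::field mpoly4)"
  unfolding clsX_eq_0_iff[symmetric] by simp

lemma homogeneous_fraction_Const: "homogeneous_fraction (Fract (clsX (Const c)) 1)"
  using homogeneous_fractionI[OF homogeneous_Const homogeneous_1 quadric_not_dvd_1] by simp

lemma homogeneous_fraction_0: "homogeneous_fraction 0"
  using homogeneous_fraction_Const[of 0] by (simp add: Const_def Zero_fract_def)

lemma homogeneous_fraction_1: "homogeneous_fraction 1"
  using homogeneous_fraction_Const[of 1] by (simp add: Const_def single_one One_fract_def)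

lemma homogeneous_fraction_mult:
  assumes "homogeneous_fraction a" "homogeneous_fraction b"
  shows "homogeneous_fraction (a * b)"
proof -
  obtain d F G d' F' G' where 1: "homogeneous d F" "homogeneous d G" "\<not> quadric dvd G"
    "a = Fract (clsX F) (clsX G)"
    and 2: "homogeneous d' F'" "homogeneous d' G'" "\<not> quadric dvd G'"
    "b = Fract (clsX F') (clsX G')"
    using assms unfolding homogeneous_fraction_def by blast
  have "homogeneous_fraction (Fract (clsX (F * F')) (clsX (G * G')))"
    using homogeneous_mult[OF 1(1) 2(1)] homogeneous_mult[OF 1(2) 2(2)] 1(3) 2(3)
    by (intro homogeneous_fractionI) (auto dest: quadric_prime)
  then show ?thesis using 1 2 by simp
qed

lemma homogeneous_fraction_add:
  assumes "homogeneous_fraction a" "homogeneous_fraction b"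
  shows "homogeneous_fraction (a + b)"
proof -
  obtain d F G d' F' G' where 1: "homogeneous d F" "homogeneous d G" "\<not> quadric dvd G"
    "a = Fract (clsX F) (clsX G)"
    and 2: "homogeneous d' F'" "homogeneous d' G'" "\<not> quadric dvd G'"
    "b = Fract (clsX F') (clsX G')"
    using assms unfolding homogeneous_fraction_def by blast
  have "homogeneous (d + d') (F * G' + F' * G)"
    using homogeneous_mult[OF 1(1) 2(2)] homogeneous_mult[OF 2(1) 1(2)]
    by (simp add: homogeneous_add add.commute)
  then have "homogeneous_fraction (Fract (clsX (F * G' + F' * G)) (clsX (G * G')))"
    using homogeneous_mult[OF 1(2) 2(2)] 1(3) 2(3)
    by (intro homogeneous_fractionI) (auto dest: quadric_prime)
  then show ?thesis using 1 2 by (simp add: clsX_eq_0_iff)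
qed

lemma homogeneous_fraction_uminus:
  assumes "homogeneous_fraction a"
  shows "homogeneous_fraction (- a)"
proof -
  obtain d F G where 1: "homogeneous d F" "homogeneous d G" "\<not> quadric dvd G"
    "a = Fract (clsX F) (clsX G)"
    using assms unfolding homogeneous_fraction_def by blast
  then show ?thesis
    using homogeneous_fractionI[of d "- F" G] by (simp add: homogeneous_uminus)
qed

lemma homogeneous_fraction_diff:
  "homogeneous_fraction a \<Longrightarrow> homogeneous_fraction b \<Longrightarrow> homogeneous_fraction (a - b)"
  using homogeneous_fraction_add[of a "- b"] by (simp add: homogeneous_fraction_uminus)

lemma homogeneous_fraction_inverse:
  assumes "homogeneous_fraction a"
  shows "homogeneous_fraction (inverse a)"
proof -
  obtain d F G where 1: "homogeneous d F" "homogeneous d G" "\<not> quadric dvd G"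
    "a = Fract (clsX F) (clsX G)"
    using assms unfolding homogeneous_fraction_def by blast
  show ?thesis
  proof (cases "quadric dvd F")
    case True
    then have "clsX F = 0" by (simp add: clsX_eq_0_iff)
    then show ?thesis
      using 1 homogeneous_fraction_0 by (simp add: eq_fract Zero_fract_def)
  next
    case False
    then show ?thesis using 1 homogeneous_fractionI[of d G F] by simp
  qed
qed

typedef (overloaded) 'k funX = "{g :: 'k::field coordX fract. homogeneous_fraction g}"
  using homogeneous_fraction_0 by blast

setup_lifting type_definition_funX

instantiation funX :: (field) field
begin
lift_definition zero_funX :: "'a funX" is 0 by (rule homogeneous_fraction_0)
lift_definition one_funX :: "'a funX" is 1 by (rule homogeneous_fraction_1)
lift_definition plus_funX :: "'a funX \<Rightarrow> 'a funX \<Rightarrow> 'a funX" is "(+)"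
  by (rule homogeneous_fraction_add)
lift_definition minus_funX :: "'a funX \<Rightarrow> 'a funX \<Rightarrow> 'a funX" is "(-)"
  by (rule homogeneous_fraction_diff)
lift_definition uminus_funX :: "'a funX \<Rightarrow> 'a funX" is uminus
  by (rule homogeneous_fraction_uminus)
lift_definition times_funX :: "'a funX \<Rightarrow> 'a funX \<Rightarrow> 'a funX" is "(*)"
  by (rule homogeneous_fraction_mult)
lift_definition inverse_funX :: "'a funX \<Rightarrow> 'a funX" is inverse
  by (rule homogeneous_fraction_inverse)
definition divide_funX :: "'a funX \<Rightarrow> 'a funX \<Rightarrow> 'a funX" where
  "divide_funX a b = a * inverse b"
instance
proof
  fix a b :: "'a funX"
  show "a div b = a * inverse b" by (rule divide_funX_def)
qed (transfer; simp add: algebra_simps)+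
end

lift_definition Const_X :: "'k::field \<Rightarrow> 'k funX" is "\<lambda>c. Fract (clsX (Const c)) 1"
  by (rule homogeneous_fraction_Const)

text \<open>The linear map defining tau, on quadruples over any commutative ring: \<open>p\<close> may be a
  point, or the quadruple of coordinate functions.\<close>

definition tau :: "(coord \<Rightarrow> 'a::comm_ring_1) \<Rightarrow> (coord \<Rightarrow> 'a)" where
  "tau p = (\<lambda>i. case i of
     CW \<Rightarrow> p CW - 2 * p CX + 2 * p CZ
   | CX \<Rightarrow> p CZ
   | CY \<Rightarrow> - p CY - 2 * p CZ
   | CZ \<Rightarrow> p CX + 4 * p CY + 4 * p CZ)"

definition tau_inv :: "(coord \<Rightarrow> 'a::comm_ring_1) \<Rightarrow> (coord \<Rightarrow> 'a)" where
  "tau_inv p = (\<lambda>i. case i of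
     CW \<Rightarrow> p CW + 6 * p CX + 8 * p CY + 2 * p CZ
   | CX \<Rightarrow> 4 * p CX + 4 * p CY + p CZ
   | CY \<Rightarrow> - 2 * p CX - p CY
   | CZ \<Rightarrow> p CX)"

lemma tau_tau_inv: "tau (tau_inv p) = p" "tau_inv (tau p) = p"
  by (rule ext, rename_tac i, case_tac i; simp add: tau_def tau_inv_def algebra_simps)+

lemma tau_preserves_X:
  "p CX * p CZ = (p CY)\<^sup>2 \<Longrightarrow> tau p CX * tau p CZ = (tau p CY)\<^sup>2"
  by (simp add: tau_def power2_eq_square algebra_simps)

definition pull :: "'k::field mpoly4 \<Rightarrow> 'k mpoly4" where
  "pull F = peval Const (tau Var) F"

definition pull_inv :: "'k::field mpoly4 \<Rightarrow> 'k mpoly4" where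
  "pull_inv F = peval Const (tau_inv Var) F"

lemma peval_tau_Var: "scalar_hom \<iota> \<Longrightarrow> (\<lambda>i. peval \<iota> p (tau Var i)) = tau p"
  by (rule ext, rename_tac i, case_tac i;
      simp add: tau_def peval_add peval_diff peval_uminus peval_mult peval_numeral peval_Var)

lemma peval_tau_inv_Var: "scalar_hom \<iota> \<Longrightarrow> (\<lambda>i. peval \<iota> p (tau_inv Var i)) = tau_inv p"
  by (rule ext, rename_tac i, case_tac i;
      simp add: tau_inv_def peval_add peval_diff peval_uminus peval_mult peval_numeral peval_Var)

text \<open>\<open>pull\<close> is composition with tau.\<close>

lemma peval_pull: "peval (\<lambda>x. x) p (pull F) = peval (\<lambda>x. x) (tau p) F"
  by (simp add: pull_def peval_comp scalar_hom_id peval_tau_Var)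

lemma pull_inv_pull: "pull_inv (pull F) = F"
  by (simp add: pull_def pull_inv_def peval_comp scalar_hom_Const peval_tau_Var tau_tau_inv peval_Var_id)

lemma pull_hom:
  "pull 0 = 0" "pull 1 = 1" "pull (F + G) = pull F + pull G" "pull (F - G) = pull F - pull G"
  "pull (F * G) = pull F * pull G" "pull (Const c) = Const c"
  by (simp_all add: pull_def scalar_hom_Const peval_1 peval_add peval_diff peval_mult peval_Const)

lemma pull_quadric: "pull quadric = quadric"
  by (simp add: pull_def quadric_def scalar_hom_Const peval_diff peval_mult peval_power peval_Var)
     (simp add: tau_def power2_eq_square algebra_simps)

lemma pull_inv_quadric: "pull_inv quadric = quadric"
  using pull_inv_pull[of quadric] by (simp add: pull_quadric)

lemma quadric_dvd_pull_iff: "quadric dvd pull F \<longleftrightarrow> quadric dvd F"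
proof
  assume "quadric dvd F"
  then show "quadric dvd pull F"
    by (auto elim!: dvdE simp: pull_hom pull_quadric)
next
  assume "quadric dvd pull F"
  then obtain H where "pull F = quadric * H" by (elim dvdE)
  then have "F = pull_inv (quadric * H)" using pull_inv_pull[of F] by simp
  also have "\<dots> = pull_inv quadric * pull_inv H"
    by (simp add: pull_inv_def peval_mult scalar_hom_Const)
  finally show "quadric dvd F" by (simp add: pull_inv_quadric)
qed

lemma homogeneous_pull: "homogeneous d F \<Longrightarrow> homogeneous d (pull F)"
  unfolding pull_def
proof (erule homogeneous_peval)
  show "homogeneous 1 (tau Var i)" for i
    by (cases i)
       (auto simp: tau_def intro!: homogeneous_add homogeneous_diff homogeneous_uminus
         homogeneous_numeral_mult homogeneous_Var[simplified])
qed

lift_definition pull_cls :: "'k::field coordX \<Rightarrow> 'k coordX" is pull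
  unfolding quadric_cong_def by (simp add: quadric_dvd_pull_iff flip: pull_hom(4))

lemma pull_cls_clsX: "pull_cls (clsX F) = clsX (pull F)"
  by (simp add: clsX_def pull_cls.abs_eq)

lemma pull_cls_hom:
  "pull_cls 0 = 0" "pull_cls 1 = 1" "pull_cls (a + b) = pull_cls a + pull_cls b"
  "pull_cls (a * b) = pull_cls a * pull_cls b"
  by (transfer; simp add: quadric_cong_iff pull_hom)+

lemma pull_cls_eq_0_iff: "pull_cls a = 0 \<longleftrightarrow> a = 0"
  by transfer (simp add: quadric_cong_def quadric_dvd_pull_iff)

lift_definition pull_fract :: "'k::field coordX fract \<Rightarrow> 'k coordX fract"
  is "\<lambda>q. (pull_cls (fst q), pull_cls (snd q))"
proof -
  fix q r :: "'k coordX \<times> 'k coordX"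
  assume "fractrel q r"
  then have q: "snd q \<noteq> 0" "snd r \<noteq> 0" "fst q * snd r = fst r * snd q" by simp_all
  have "pull_cls (fst q * snd r) = pull_cls (fst r * snd q)" by (simp only: q(3))
  then have "pull_cls (fst q) * pull_cls (snd r) = pull_cls (fst r) * pull_cls (snd q)"
    by (simp only: pull_cls_hom)
  then show "fractrel (pull_cls (fst q), pull_cls (snd q)) (pull_cls (fst r), pull_cls (snd r))"
    using q(1,2) by (simp add: pull_cls_eq_0_iff)
qed

lemma pull_fract_Fract: "b \<noteq> 0 \<Longrightarrow> pull_fract (Fract a b) = Fract (pull_cls a) (pull_cls b)"
  by transfer (simp add: pull_cls_eq_0_iff)

lemma pull_fract_hom:
  "pull_fract 1 = 1" "pull_fract (a + b) = pull_fract a + pull_fract b"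
  "pull_fract (a * b) = pull_fract a * pull_fract b"
proof -
  show "pull_fract 1 = 1"
    by (simp add: One_fract_def pull_fract_Fract pull_cls_hom)
  show "pull_fract (a + b) = pull_fract a + pull_fract b"
    by (cases a; cases b) (simp add: pull_fract_Fract pull_cls_hom pull_cls_eq_0_iff)
  show "pull_fract (a * b) = pull_fract a * pull_fract b"
    by (cases a; cases b) (simp add: pull_fract_Fract pull_cls_hom)
qed

lift_definition tau_star :: "'k::field funX \<Rightarrow> 'k funX" is pull_fract
proof -
  fix g :: "'k coordX fract"
  assume "homogeneous_fraction g"
  then obtain d F G where 1: "homogeneous d F" "homogeneous d G" "\<not> quadric dvd G"
    "g = Fract (clsX F) (clsX G)"
    unfolding homogeneous_fraction_def by blast
  then show "homogeneous_fraction (pull_fract g)"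
    using homogeneous_fractionI[of d "pull F" "pull G"]
    by (simp add: pull_fract_Fract clsX_eq_0_iff pull_cls_clsX homogeneous_pull quadric_dvd_pull_iff)
qed

lemma tau_star_hom:
  "tau_star 1 = 1" "tau_star (a + b) = tau_star a + tau_star b"
  "tau_star (a * b) = tau_star a * tau_star b"
  by (transfer; rule pull_fract_hom)+

lift_definition f_X :: "'k::field_char_0 funX" is
  "Fract (clsX (Var CW + 12 * Var CX + 22 * Var CY + 8 * Var CZ))
         (clsX (12 * Var CX + 6 * Var CY))"
proof (rule homogeneous_fractionI)
  show "homogeneous 1 (Var CW + 12 * Var CX + 22 * Var CY + 8 * Var CZ)"
    by (intro homogeneous_add homogeneous_numeral_mult homogeneous_Var)
  show "homogeneous 1 (12 * Var CX + 6 * Var CY)"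
    by (intro homogeneous_add homogeneous_numeral_mult homogeneous_Var)
  show "\<not> quadric dvd (12 * Var CX + 6 * Var CY :: 'k mpoly4)"
  proof
    assume "quadric dvd (12 * Var CX + 6 * Var CY :: 'k mpoly4)"
    then obtain H :: "'k mpoly4" where H: "12 * Var CX + 6 * Var CY = quadric * H" by (elim dvdE)
    define p :: "coord \<Rightarrow> 'k" where "p = (\<lambda>i. if i = CX then 1 else 0)"
    have "peval (\<lambda>x. x) p (12 * Var CX + 6 * Var CY) = peval (\<lambda>x. x) p (quadric * H)"
      by (simp add: H)
    then show False
      by (simp add: scalar_hom_id peval_add peval_mult peval_numeral peval_Var quadric_def
            peval_diff peval_power p_def)
  qed
qed


section \<open>Skew polynomial rings\<close>

class ring_endo = ring_1 +
  fixes twist :: "'a \<Rightarrow> 'a"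
  assumes twist_1: "twist 1 = 1"
    and twist_add: "twist (a + b) = twist a + twist b"
    and twist_mult: "twist (a * b) = twist a * twist b"
begin

lemma twist_0: "twist 0 = 0"
  using twist_add[of 0 0] by simp

lemma twist_pow:
  "(twist ^^ n) 0 = 0" "(twist ^^ n) 1 = 1" "(twist ^^ n) (a + b) = (twist ^^ n) a + (twist ^^ n) b"
  "(twist ^^ n) (a * b) = (twist ^^ n) a * (twist ^^ n) b"
  by (induction n) (simp_all add: twist_0 twist_1 twist_add twist_mult)

lemma twist_pow_sum: "(twist ^^ n) (sum h A) = (\<Sum>i\<in>A. (twist ^^ n) (h i))"
  by (induction A rule: infinite_finite_induct) (simp_all add: twist_pow)

end

instantiation funX :: (field) ring_endo
begin
definition twist_funX :: "'a funX \<Rightarrow> 'a funX" where "twist_funX = tau_star"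
instance by standard (simp_all add: twist_funX_def tau_star_hom)
end

text \<open>Coefficient sequences of the polynomials $\sum_i a_i t^i$, coefficients on the left;
  the product is determined by $t a = \mathit{twist}(a) t$.\<close>

typedef (overloaded) 'a skew_poly = "{h :: nat \<Rightarrow> 'a::zero. \<exists>N. \<forall>n>N. h n = 0}"
  morphisms skew_coeff Abs_skew_poly
  by auto

setup_lifting type_definition_skew_poly

instantiation skew_poly :: (ring_endo) ring_1
begin
lift_definition zero_skew_poly :: "'a skew_poly" is "\<lambda>_. 0" by simp
lift_definition one_skew_poly :: "'a skew_poly" is "\<lambda>n. if n = 0 then 1 else 0" by auto
lift_definition plus_skew_poly :: "'a skew_poly \<Rightarrow> 'a skew_poly \<Rightarrow> 'a skew_poly"
  is "\<lambda>p q n. p n + q n"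
  by (metis add_0 max_less_iff_conj)
lift_definition minus_skew_poly :: "'a skew_poly \<Rightarrow> 'a skew_poly \<Rightarrow> 'a skew_poly"
  is "\<lambda>p q n. p n - q n"
  by (metis diff_0_right max_less_iff_conj)
lift_definition uminus_skew_poly :: "'a skew_poly \<Rightarrow> 'a skew_poly" is "\<lambda>p n. - p n"
  by auto
lift_definition times_skew_poly :: "'a skew_poly \<Rightarrow> 'a skew_poly \<Rightarrow> 'a skew_poly"
  is "\<lambda>p q n. \<Sum>i=0..n. p i * (twist ^^ i) (q (n - i))"
proof -
  fix p q :: "nat \<Rightarrow> 'a"
  assume "\<exists>N. \<forall>n>N. p n = 0" "\<exists>N. \<forall>n>N. q n = 0"
  then obtain N M where N: "\<And>n. n > N \<Longrightarrow> p n = 0" and M: "\<And>n. n > M \<Longrightarrow> q n = 0" by blast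
  have "p i * (twist ^^ i) (q (n - i)) = 0" if "n > N + M" for n i
  proof (cases "i > N")
    case False
    then have "n - i > M" using that by simp
    then show ?thesis using M by (simp add: twist_pow)
  qed (simp add: N)
  then have "\<forall>n>N + M. (\<Sum>i=0..n. p i * (twist ^^ i) (q (n - i))) = 0" by simp
  then show "\<exists>N. \<forall>n>N. (\<Sum>i=0..n. p i * (twist ^^ i) (q (n - i))) = 0" by blast
qed
instance
proof
  fix a b c :: "'a skew_poly"
  show "a * b * c = a * (b * c)"
  proof (transfer, rule ext)
    fix a b c :: "nat \<Rightarrow> 'a" and n
    have triangle: "(\<Sum>j=0..k. \<Sum>i=0..j. F i (j - i) (n - j)) =
        (\<Sum>j=0..k. \<Sum>i=0..k - j. F j i (n - j - i))" for k and F :: "nat \<Rightarrow> nat \<Rightarrow> nat \<Rightarrow> 'a"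
      by (induct k) (simp_all add: Suc_diff_le sum.distrib add.assoc)
    have "(\<Sum>j=0..n. (\<Sum>i=0..j. a i * (twist ^^ i) (b (j - i))) * (twist ^^ j) (c (n - j))) =
      (\<Sum>j=0..n. \<Sum>i=0..j. a i * (twist ^^ i) (b (j - i)) * (twist ^^ (i + (j - i))) (c (n - j)))"
      by (simp add: sum_distrib_right)
    also have "\<dots> = (\<Sum>j=0..n. \<Sum>i=0..n - j.
        a j * (twist ^^ j) (b i) * (twist ^^ (j + i)) (c (n - j - i)))"
      by (rule triangle)
    also have "\<dots> = (\<Sum>j=0..n. a j * (twist ^^ j) (\<Sum>i=0..n - j. b i * (twist ^^ i) (c (n - j - i))))"
      by (simp add: twist_pow_sum twist_pow sum_distrib_left mult.assoc funpow_add)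
    finally show "(\<Sum>j=0..n. (\<Sum>i=0..j. a i * (twist ^^ i) (b (j - i))) * (twist ^^ j) (c (n - j))) =
      (\<Sum>j=0..n. a j * (twist ^^ j) (\<Sum>i=0..n - j. b i * (twist ^^ i) (c (n - j - i))))" .
  qed
  show "1 * a = a"
  proof (transfer, rule ext)
    fix a :: "nat \<Rightarrow> 'a" and n
    have "(\<Sum>i=0..n. (if i = 0 then 1 else 0) * (twist ^^ i) (a (n - i))) =
      (\<Sum>i=0..n. if i = 0 then a n else 0)"
      by (rule sum.cong) auto
    then show "(\<Sum>i=0..n. (if i = 0 then 1 else 0) * (twist ^^ i) (a (n - i))) = a n" by simp
  qed
  show "a * 1 = a"
  proof (transfer, rule ext)
    fix a :: "nat \<Rightarrow> 'a" and n
    have "(\<Sum>i=0..n. a i * (twist ^^ i) (if n - i = 0 then 1 else 0)) =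
      (\<Sum>i=0..n. if i = n then a n else 0)"
      by (rule sum.cong) (auto simp: twist_pow)
    then show "(\<Sum>i=0..n. a i * (twist ^^ i) (if n - i = 0 then 1 else 0)) = a n" by simp
  qed
  show "(a + b) * c = a * c + b * c"
    by (transfer, rule ext) (simp add: distrib_right sum.distrib)
  show "a * (b + c) = a * b + a * c"
    by (transfer, rule ext) (simp add: twist_pow distrib_left sum.distrib)
  show "(0::'a skew_poly) \<noteq> 1"
    by transfer (metis zero_neq_one)
qed (transfer; simp add: algebra_simps)+
end

lift_definition skew_const :: "'a::zero \<Rightarrow> 'a skew_poly" is "\<lambda>a n. if n = 0 then a else 0"
  by auto

lift_definition skew_t :: "'a::zero_neq_one skew_poly" is "\<lambda>n. if n = 1 then 1 else 0"
  by auto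

lemma skew_t_commute: "skew_t * skew_const a = skew_const (twist a) * (skew_t :: 'a::ring_endo skew_poly)"
proof (transfer, rule ext)
  fix a :: 'a and n :: nat
  have "(\<Sum>i=0..n. (if i = 1 then 1 else 0) * (twist ^^ i) (if n - i = 0 then a else 0)) =
    (\<Sum>i=0..n. if i = 1 then (if n = 1 then twist a else 0) else 0)"
    by (rule sum.cong) (auto simp: twist_0)
  also have "\<dots> = (\<Sum>i=0..n. if i = 0 then (if n = 1 then twist a else 0) else 0)" by auto
  also have "\<dots> = (\<Sum>i=0..n. (if i = 0 then twist a else 0) * (twist ^^ i) (if n - i = 1 then 1 else 0))"
    by (rule sum.cong) auto
  finally show "(\<Sum>i=0..n. (if i = 1 then 1 else 0) * (twist ^^ i) (if n - i = 0 then a else 0)) =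
    (\<Sum>i=0..n. (if i = 0 then twist a else 0) * (twist ^^ i) (if n - i = 1 then 1 else 0))" .
qed

definition skewX_scale :: "'k::field \<Rightarrow> 'k funX skew_poly \<Rightarrow> 'k funX skew_poly" where
  "skewX_scale c p = skew_const (Const_X c) * p"

lemma skew_const_hom:
  "skew_const (a + b) = skew_const a + skew_const (b::'a::ring_endo)"
  "skew_const (a * b) = skew_const a * skew_const b"
  "skew_const 1 = (1::'a skew_poly)"
proof -
  show "skew_const (a + b) = skew_const a + skew_const b" by transfer auto
  show "skew_const 1 = (1::'a skew_poly)" by transfer auto
  show "skew_const (a * b) = skew_const a * skew_const b"
  proof (transfer, rule ext)
    fix a b :: 'a and n :: nat
    have "(\<Sum>i=0..n. (if i = 0 then a else 0) * (twist ^^ i) (if n - i = 0 then b else 0)) =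
      (\<Sum>i=0..n. if i = 0 then (if n = 0 then a * b else 0) else 0)"
      by (rule sum.cong) auto
    then show "(if n = 0 then a * b else 0) =
      (\<Sum>i=0..n. (if i = 0 then a else 0) * (twist ^^ i) (if n - i = 0 then b else 0))" by simp
  qed
qed

lemma Const_hom: "Const (a + b) = Const a + Const b" "Const (a * b) = Const a * Const b"
  "Const 1 = 1"
  by (simp_all add: Const_def single_add single_one mult_single)

lemma Const_X_hom: "Const_X (a + b) = Const_X a + Const_X b" "Const_X (a * b) = Const_X a * Const_X b"
  "Const_X 1 = 1"
  by (transfer; simp add: Const_hom One_fract_def)+

lemma vector_space_skewX_scale: "vector_space skewX_scale"
  by unfold_locales
     (simp_all add: skewX_scale_def algebra_simps Const_X_hom skew_const_hom)

end

theory Submission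
  imports Defs "HOL-Computational_Algebra.Polynomial"
begin

text \<open>Let $\Bbbk[r, s][t]$ be the skew polynomial ring with $t s = (s - 1) t$ and \<open>r\<close> central. The
  algebra S embeds into it by $u \mapsto s t$, $v \mapsto t$, $w \mapsto r t$, so that $\phi(e_n)$
  becomes $(s - (n - 1) r) t^n$; putting $r = a$ gives $\lambda_a$. Hence $\phi(x) = 0$ if and only
  if all $\lambda_a(x)$ vanish, as $\Bbbk$ is infinite. On the other hand $\Bbbk(X) = \Bbbk(r, s)$ for
  suitable coordinates with $\tau^* s = s - 1$ and $\tau^* r = r$, and $t \mapsto s^{-1} t$ extends to
  an injective homomorphism $\Bbbk[r, s][t] \to \Bbbk(X)[t; \tau^*]$ carrying $\phi$ to $\rho$, since
  both composites agree on the generators $e_1$, $e_2$ and $f = (s - r) / (s (s - 1))$.\<close>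

text \<open>The rescaling of t is dictated by the two normalisations of e_1, which becomes s t under
  \<open>phi\<close> and t under \<open>rho\<close>. The square of s^{-1} t is s^{-1} (s - 1)^{-1}
  t^2; this is where the denominator s (s - 1) in the formula for f comes from. Two injectivity
  statements carry the proof. S is given by generators and relations, so its elements first need a
  normal form: ordered monomials in u, w, v span it, and their images are linearly independent
  because they are triangular in the degree in s. For k(X) the point is the algebraic independence
  of r and s. It is tested on an explicit family of points of X that realises every pair of values
  of s and r.\<close>

section \<open>Unital ring homomorphisms\<close>

locale unital_hom =
  fixes h :: "'a::ring_1 \<Rightarrow> 'b::ring_1"
  assumes hom_1: "h 1 = 1"
    and hom_add: "h (a + b) = h a + h b"
    and hom_mult: "h (a * b) = h a * h b"
begin

lemma hom_0: "h 0 = 0"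
  using hom_add[of 0 0] by simp

lemma hom_uminus: "h (- a) = - h a"
  using hom_add[of a "- a"] by (simp add: hom_0 eq_neg_iff_add_eq_0 add.commute)

lemma hom_diff: "h (a - b) = h a - h b"
  using hom_add[of a "- b"] by (simp add: hom_uminus)

lemma hom_sum: "h (sum f A) = (\<Sum>i\<in>A. h (f i))"
  by (induction A rule: infinite_finite_induct) (simp_all add: hom_0 hom_add)

lemma hom_power: "h (a ^ n) = h a ^ n"
  by (induction n) (simp_all add: hom_1 hom_mult)

lemma hom_of_nat: "h (of_nat n) = of_nat n"
  by (induction n) (simp_all add: hom_0 hom_1 hom_add)

end

lemma unital_hom_comp:
  assumes "unital_hom g" "unital_hom h"
  shows "unital_hom (\<lambda>x. g (h x))"
  using assms unfolding unital_hom_def by simp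

lemma unital_hom_pCons: "unital_hom (\<lambda>c::'a::comm_ring_1. [:c:])"
  by unfold_locales (simp_all add: one_pCons)

lemma unital_hom_poly: "unital_hom (\<lambda>p. poly p (x::'a::comm_ring_1))"
  by unfold_locales simp_all

lemma unital_hom_map_poly:
  fixes h :: "'a::comm_ring_1 \<Rightarrow> 'b::comm_ring_1"
  assumes "unital_hom h"
  shows "unital_hom (map_poly h)"
proof -
  interpret unital_hom h by fact
  show ?thesis
  proof
    show "map_poly h 1 = 1"
      by (rule poly_eqI) (simp add: coeff_map_poly hom_0 hom_1)
    show "map_poly h (p + q) = map_poly h p + map_poly h q" for p q
      by (rule poly_eqI) (simp add: coeff_map_poly hom_0 hom_add)
    show "map_poly h (p * q) = map_poly h p * map_poly h q" for p q
      by (rule poly_eqI) (simp add: coeff_map_poly coeff_mult hom_0 hom_sum hom_mult)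
  qed
qed


section \<open>Evaluation of free algebras\<close>

text \<open>Scalars of the free algebra commute with all words. A ring homomorphism with prescribed
  values on letters therefore needs scalar images that commute with these values.\<close>

locale central_hom = unital_hom \<kappa>
  for \<kappa> :: "'k::field \<Rightarrow> 'b::ring_1" +
  assumes central: "\<kappa> c * y = y * \<kappa> c"

definition free_eval ::
  "('k::field \<Rightarrow> 'b::ring_1) \<Rightarrow> ('x \<Rightarrow> 'b) \<Rightarrow> ('x, 'k) free_algebra \<Rightarrow> 'b" where
  "free_eval \<kappa> f = psum (\<lambda>m a. \<kappa> a * (case m of Letters xs \<Rightarrow> prod_list (map f xs)))"

context central_hom
begin

lemma free_eval_single:
  "free_eval \<kappa> f (Poly_Mapping.single (Letters xs) a) = \<kappa> a * prod_list (map f xs)"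
  unfolding free_eval_def by (subst psum_single) (simp_all add: hom_0)

lemma free_eval_add: "free_eval \<kappa> f (p + q) = free_eval \<kappa> f p + free_eval \<kappa> f q"
  unfolding free_eval_def by (rule psum_add) (simp_all add: hom_0 hom_add distrib_right)

lemma free_eval_scalar: "free_eval \<kappa> f (Poly_Mapping.single 0 c) = \<kappa> c"
  by (simp add: zero_free_monoid_def free_eval_single)

lemma free_eval_gen: "free_eval \<kappa> f (gen x) = f x"
  by (simp add: gen_def free_eval_single hom_1)

lemma unital_hom_free_eval: "unital_hom (free_eval \<kappa> f)"
proof
  show "free_eval \<kappa> f 1 = 1"
    using free_eval_scalar[of f 1] by (simp add: hom_1 single_one)
  show "free_eval \<kappa> f (p + q) = free_eval \<kappa> f p + free_eval \<kappa> f q" for p q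
    by (rule free_eval_add)
  have 0: "free_eval \<kappa> f 0 = 0" by (simp add: free_eval_def)
  show "free_eval \<kappa> f (p * q) = free_eval \<kappa> f p * free_eval \<kappa> f q" for p q
  proof (induction p rule: poly_mapping_add_induct)
    case (single i a)
    show ?case
    proof (induction q rule: poly_mapping_add_induct)
      case (single j b)
      obtain xs ys where [simp]: "i = Letters xs" "j = Letters ys"
        by (cases i; cases j) blast
      have "free_eval \<kappa> f (Poly_Mapping.single i a * Poly_Mapping.single j b) =
        \<kappa> a * (\<kappa> b * prod_list (map f xs)) * prod_list (map f ys)"
        by (simp add: mult_single free_eval_single hom_mult mult.assoc)
      also have "\<kappa> b * prod_list (map f xs) = prod_list (map f xs) * \<kappa> b"
        by (rule central)
      finally show ?case by (simp add: free_eval_single mult.assoc)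
    qed (simp_all add: 0 free_eval_add distrib_left)
  qed (simp_all add: 0 free_eval_add distrib_right)
qed

lemma free_eval_fscale: "free_eval \<kappa> f (fscale c p) = \<kappa> c * free_eval \<kappa> f p"
  unfolding fscale_def by (simp add: unital_hom.hom_mult[OF unital_hom_free_eval] free_eval_scalar)

text \<open>The universal property of a presented algebra. Vanishing on the relations passes to
  two-sided multiples and sums, hence to the whole ideal.\<close>

lemma free_eval_ideal_cong:
  assumes G: "\<And>g. g \<in> G \<Longrightarrow> free_eval \<kappa> f g = 0" and "ideal_cong G p q"
  shows "free_eval \<kappa> f p = free_eval \<kappa> f q"
proof -
  interpret e: unital_hom "free_eval \<kappa> f" by (rule unital_hom_free_eval)
  have "free_eval \<kappa> f a = 0" if "a \<in> ideal_gen G" for a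
    using that by induction (simp_all add: e.hom_0 e.hom_add e.hom_mult G)
  then show ?thesis
    using assms(2) e.hom_diff[of p q] by (simp add: ideal_cong_def)
qed

end


section \<open>Skew polynomials\<close>

lemma skew_poly_eqI: "(\<And>n. skew_coeff p n = skew_coeff q n) \<Longrightarrow> p = q"
  by (metis ext skew_coeff_inject)

lemma skew_coeff_const_mult: "skew_coeff (skew_const a * p) n = a * skew_coeff p n"
  for p :: "'a::ring_endo skew_poly"
proof -
  have "skew_coeff (skew_const a * p) n = (\<Sum>i=0..n. if i = 0 then a * skew_coeff p n else 0)"
    unfolding times_skew_poly.rep_eq by (rule sum.cong) (auto simp: skew_const.rep_eq)
  then show ?thesis by simp
qed

lemma skew_coeff_mult_const: "skew_coeff (p * skew_const a) n = skew_coeff p n * (twist ^^ n) a"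
  for p :: "'a::ring_endo skew_poly"
proof -
  have "skew_coeff (p * skew_const a) n =
      (\<Sum>i=0..n. if i = n then skew_coeff p n * (twist ^^ n) a else 0)"
    unfolding times_skew_poly.rep_eq
    by (rule sum.cong) (auto simp: skew_const.rep_eq twist_pow)
  then show ?thesis by simp
qed

lemma skew_coeff_mult_t: "skew_coeff (p * skew_t) n = (if n = 0 then 0 else skew_coeff p (n - 1))"
  for p :: "'a::ring_endo skew_poly"
proof -
  have "skew_coeff (p * skew_t) n =
      (\<Sum>i=0..n. if i = n - 1 then if n = 0 then 0 else skew_coeff p (n - 1) else 0)"
    unfolding times_skew_poly.rep_eq
    by (rule sum.cong) (auto simp: skew_t.rep_eq twist_pow)
  then show ?thesis by simp
qed

lemma skew_coeff_monomial:
  "skew_coeff (skew_const a * skew_t ^ m) n = (if n = m then a else (0::'a::ring_endo))"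
proof (induction m arbitrary: n)
  case 0
  show ?case by (simp add: skew_const.rep_eq)
next
  case (Suc m)
  have "skew_const a * skew_t ^ Suc m = skew_const a * skew_t ^ m * skew_t"
    by (simp only: power_Suc2 mult.assoc)
  then show ?case
    using Suc by (auto simp: skew_coeff_mult_t simp del: power_Suc)
qed

lemma skew_const_commute:
  fixes a :: "'a::{ring_endo, comm_ring_1}"
  assumes "twist a = a"
  shows "skew_const a * p = p * skew_const a"
proof (rule skew_poly_eqI)
  fix n
  have "(twist ^^ n) a = a" by (induction n) (simp_all add: assms)
  then show "skew_coeff (skew_const a * p) n = skew_coeff (p * skew_const a) n"
    by (simp add: skew_coeff_const_mult skew_coeff_mult_const mult.commute)
qed

lemma skew_t_power_const:
  fixes a :: "'a::{ring_endo, comm_ring_1}"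
  assumes "twist a = a"
  shows "skew_t ^ n * skew_const a = skew_const a * skew_t ^ n"
  using skew_const_commute[OF assms] by simp

lemma unital_hom_skew_const: "unital_hom (skew_const :: 'a::ring_endo \<Rightarrow> 'a skew_poly)"
  by unfold_locales (rule skew_const_hom)+

text \<open>The homomorphism $\sum_n p_n t^n \mapsto \sum_n h(p_n) c_n t^n$; it maps $t$ to $c_1 t$ and $c_n t^n = (c_1 t)^n$.\<close>

lift_definition skew_map :: "('a::ring_endo \<Rightarrow> 'b::ring_endo) \<Rightarrow> (nat \<Rightarrow> 'b) \<Rightarrow> 'a skew_poly \<Rightarrow> 'b skew_poly"
  is "\<lambda>h c p n. if p n = 0 then 0 else h (p n) * c n"
  by auto

text \<open>\<open>cocycle_add\<close> says that (c_m t^m)(c_n t^n) = c_{m+n} t^{m+n}, and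
  \<open>hom_twist\<close> that h respects the rule for moving t past a coefficient. Commutativity
  of the target allows c_m to be moved past the image of the second coefficient.\<close>

locale skew_hom = unital_hom h
  for h :: "'a::ring_endo \<Rightarrow> 'b::{ring_endo, comm_ring_1}" +
  fixes c :: "nat \<Rightarrow> 'b"
  assumes hom_twist: "h (twist a) = twist (h a)"
    and cocycle_0: "c 0 = 1"
    and cocycle_add: "c (m + n) = c m * (twist ^^ m) (c n)"
begin

text \<open>The case distinction in \<open>skew_map\<close> keeps supports finite for an arbitrary
  map h; it disappears here because h 0 = 0.\<close>

lemma skew_coeff_map: "skew_coeff (skew_map h c p) n = h (skew_coeff p n) * c n"
  by (simp add: skew_map.rep_eq hom_0)

lemma hom_twist_pow: "h ((twist ^^ n) a) = (twist ^^ n) (h a)"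
  by (induction n) (simp_all add: hom_twist)

lemma unital_hom_skew_map: "unital_hom (skew_map h c)"
proof
  show "skew_map h c 1 = 1"
    by (rule skew_poly_eqI)
       (simp add: skew_coeff_map one_skew_poly.rep_eq hom_0 hom_1 cocycle_0)
  show "skew_map h c (p + q) = skew_map h c p + skew_map h c q" for p q
    by (rule skew_poly_eqI)
       (simp add: skew_coeff_map plus_skew_poly.rep_eq hom_add distrib_right)
  show "skew_map h c (p * q) = skew_map h c p * skew_map h c q" for p q
  proof (rule skew_poly_eqI)
    fix n
    have "h (skew_coeff p i * (twist ^^ i) (skew_coeff q (n - i))) * c n =
        h (skew_coeff p i) * c i * (twist ^^ i) (h (skew_coeff q (n - i)) * c (n - i))"
      if "i \<in> {0..n}" for i
      using that cocycle_add[of i "n - i"] by (simp add: hom_mult hom_twist_pow twist_pow mult_ac)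
    then show "skew_coeff (skew_map h c (p * q)) n = skew_coeff (skew_map h c p * skew_map h c q) n"
      by (simp add: skew_coeff_map times_skew_poly.rep_eq hom_sum sum_distrib_right)
  qed
qed

lemma skew_map_const: "skew_map h c (skew_const a) = skew_const (h a)"
  by (rule skew_poly_eqI) (simp add: skew_coeff_map skew_const.rep_eq hom_0 cocycle_0)

lemma skew_map_t: "skew_map h c skew_t = skew_const (c 1) * skew_t"
  by (rule skew_poly_eqI)
     (simp add: skew_coeff_map skew_coeff_const_mult skew_t.rep_eq hom_0 hom_1)

end


section \<open>The shift on polynomials\<close>

text \<open>The shift p(s) to p(s - 1) moves only the outer variable, so one instance serves both
  k[s] and k[r][s], with r fixed in the latter.\<close>

instantiation poly :: (comm_ring_1) ring_endo
begin
definition twist_poly :: "'a poly \<Rightarrow> 'a poly" where "twist_poly p = pcompose p [:-1, 1:]"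
instance
  by standard (simp_all only: twist_poly_def pcompose_1 pcompose_add pcompose_mult)
end

lemma twist_poly_const [simp]: "twist [:c:] = [:c:]"
  by (simp add: twist_poly_def)

lemma twist_poly_X: "twist [:0, 1:] = [:0, 1:] - (1 :: 'a::comm_ring_1 poly)"
  by (simp add: twist_poly_def pcompose_pCons one_pCons)

lemma twist_poly_pCons: "twist (pCons a p) = [:a:] + [:-1, 1:] * twist p"
  by (simp add: twist_poly_def pcompose_pCons)

lemma map_poly_twist:
  fixes h :: "'a::comm_ring_1 \<Rightarrow> 'b::comm_ring_1"
  assumes "unital_hom h"
  shows "map_poly h (twist p) = twist (map_poly h p)"
proof -
  interpret unital_hom h by fact
  interpret m: unital_hom "map_poly h" by (rule unital_hom_map_poly) fact
  show ?thesis
  proof (induction p)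
    case (pCons a p)
    have "map_poly h [:-1, 1:] = [:-1, 1:]" "map_poly h [:a:] = [:h a:]"
      by (simp_all add: map_poly_pCons hom_0 hom_1 hom_uminus)
    with pCons show ?case
      by (simp only: twist_poly_pCons m.hom_add m.hom_mult map_poly_pCons[of h, OF hom_0])
  qed (simp add: twist_poly_def)
qed


section \<open>Embedding S into a skew polynomial ring\<close>

text \<open>The coefficient ring is $\Bbbk[r][s]$, with \<open>s\<close> the outer variable and
  $t s = (s - 1) t$.\<close>

definition S_const :: "'k::field \<Rightarrow> 'k poly poly skew_poly" where
  "S_const c = skew_const [:[:c:]:]"

definition S_gens :: "gen_S \<Rightarrow> 'k::field poly poly skew_poly" where
  "S_gens g = (case g of
     SU \<Rightarrow> skew_const [:0, 1:] * skew_t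
   | SV \<Rightarrow> skew_t
   | SW \<Rightarrow> skew_const [:[:0, 1:]:] * skew_t)"

interpretation S_const: central_hom "S_const :: 'k::field \<Rightarrow> 'k poly poly skew_poly"
proof -
  have "unital_hom (S_const :: 'k \<Rightarrow> 'k poly poly skew_poly)"
    unfolding S_const_def
    by (intro unital_hom_comp[OF unital_hom_skew_const] unital_hom_comp[OF unital_hom_pCons]
        unital_hom_pCons)
  then show "central_hom (S_const :: 'k \<Rightarrow> 'k poly poly skew_poly)"
    by (simp add: central_hom_def central_hom_axioms_def S_const_def skew_const_commute)
qed

lemma skew_t_const_mult:
  "skew_t * (skew_const a * p) = skew_const (twist a) * (skew_t * p)" for p :: "'a::ring_endo skew_poly"
  by (metis mult.assoc skew_t_commute)

lemma skew_const_mult_assoc: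
  "skew_const a * (skew_const b * p) = skew_const (a * b) * p" for p :: "'a::ring_endo skew_poly"
  by (simp add: skew_const_hom mult.assoc)

text \<open>Everything comes from s - (s - 1) = 1: the first two commutators become (s - (s - 1))
  t^2 and r (s - (s - 1)) t^2.\<close>

lemma relations_S_vanish:
  fixes g :: "(gen_S, 'k::field) free_algebra"
  assumes "g \<in> relations_S"
  shows "free_eval S_const S_gens g = 0"
proof -
  interpret e: unital_hom "free_eval S_const S_gens :: (gen_S, 'k) free_algebra \<Rightarrow> 'k::field poly poly skew_poly"
    by (rule S_const.unital_hom_free_eval)
  have uv: "S_gens SU * S_gens SV - S_gens SV * S_gens SU = (S_gens SV ^ 2 :: 'k poly poly skew_poly)"
    by (simp add: S_gens_def skew_t_const_mult twist_poly_X mult.assoc power2_eq_square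
        unital_hom.hom_diff[OF unital_hom_skew_const] skew_const_hom left_diff_distrib)
  have uw: "S_gens SU * S_gens SW - S_gens SW * S_gens SU = (S_gens SV * S_gens SW :: 'k poly poly skew_poly)"
    by (simp add: S_gens_def skew_t_const_mult twist_poly_X mult.assoc skew_const_mult_assoc
        flip: left_diff_distrib unital_hom.hom_diff[OF unital_hom_skew_const])
       (simp add: algebra_simps one_pCons)
  have vw: "S_gens SV * S_gens SW = (S_gens SW * S_gens SV :: 'k poly poly skew_poly)"
    by (simp add: S_gens_def skew_t_const_mult mult.assoc)
  from assms show ?thesis
    unfolding relations_S_def
    by (auto simp: e.hom_diff e.hom_mult e.hom_power S_const.free_eval_gen uv uw vw)
qed

lift_definition S_embed :: "'k::field alg_S \<Rightarrow> 'k poly poly skew_poly"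
  is "free_eval S_const S_gens"
  by (rule S_const.free_eval_ideal_cong[OF relations_S_vanish])

interpretation S_embed: unital_hom "S_embed :: 'k::field alg_S \<Rightarrow> 'k poly poly skew_poly"
  by unfold_locales
     (transfer; simp add: unital_hom.hom_1[OF S_const.unital_hom_free_eval]
        unital_hom.hom_add[OF S_const.unital_hom_free_eval]
        unital_hom.hom_mult[OF S_const.unital_hom_free_eval])+

lemma S_embed_scale: "S_embed (S_scale c y) = S_const c * S_embed y"
  by transfer (rule S_const.free_eval_fscale)

lemma S_embed_gens:
  "S_embed S_u = skew_const [:0, 1:] * skew_t"
  "S_embed S_v = skew_t"
  "S_embed S_w = skew_const [:[:0, 1:]:] * skew_t"
  by (transfer; simp add: S_const.free_eval_gen S_gens_def)+

section \<open>Spanning of S by the ordered monomials u^k w^i v^j\<close>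

interpretation S_space: vector_space S_scale
  by (rule vector_space_S_scale)

lemma S_scale_mult: "S_scale c x * y = S_scale c (x * y)" "x * S_scale c y = S_scale c (x * y)"
  by (transfer; simp add: fscale_mult ideal_cong_refl)+

lemma S_relations:
  "S_u * S_v - S_v * S_u = (S_v ^ 2 :: 'k::field alg_S)"
  "S_u * S_w - S_w * S_u = (S_v * S_w :: 'k alg_S)"
  "S_v * S_w = (S_w * S_v :: 'k alg_S)"
proof -
  have "p - q \<in> relations_S \<Longrightarrow> ideal_cong relations_S p (q :: (gen_S, 'k) free_algebra)" for p q
    unfolding ideal_cong_def using ideal_gen_gen[of "p - q" relations_S 1 1] by simp
  note rel = this
  show "S_u * S_v - S_v * S_u = (S_v ^ 2 :: 'k alg_S)"
    unfolding power2_eq_square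
    by (transfer, rule rel) (simp add: relations_S_def power2_eq_square)
  show "S_u * S_w - S_w * S_u = (S_v * S_w :: 'k alg_S)" "S_v * S_w = (S_w * S_v :: 'k alg_S)"
    by (transfer, rule rel, simp add: relations_S_def)+
qed

definition S_monomial :: "nat \<times> nat \<times> nat \<Rightarrow> 'k::field alg_S" where
  "S_monomial = (\<lambda>(k, i, j). S_u ^ k * S_w ^ i * S_v ^ j)"

definition S_comb :: "(nat \<times> nat \<times> nat \<Rightarrow>\<^sub>0 'k) \<Rightarrow> 'k::field alg_S" where
  "S_comb = psum (\<lambda>m a. S_scale a (S_monomial m))"

lemma S_comb_single: "S_comb (Poly_Mapping.single m a) = S_scale a (S_monomial m)"
  unfolding S_comb_def by (rule psum_single) simp

lemma S_comb_add: "S_comb (p + q) = S_comb p + S_comb q"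
  unfolding S_comb_def by (rule psum_add) (simp_all add: S_space.scale_left_distrib)

lemma S_v_power_w: "S_v ^ j * S_w = S_w * (S_v ^ j :: 'k::field alg_S)"
  by (induction j) (simp_all add: mult.assoc, metis S_relations(3) mult.assoc)

lemma S_v_power_u: "S_v ^ j * S_u = (S_u * S_v ^ j - of_nat j * S_v ^ Suc j :: 'k::field alg_S)"
proof (induction j)
  case (Suc j)
  have "S_v ^ Suc j * S_u = S_v * (S_u * S_v ^ j - of_nat j * S_v ^ Suc j :: 'k alg_S)"
    using Suc by (simp add: mult.assoc)
  also have "\<dots> = (S_u * S_v - S_v ^ 2) * S_v ^ j - of_nat j * S_v ^ Suc (Suc j)"
    using S_relations(1)[where 'k='k]
    by (simp add: algebra_simps flip: mult_of_nat_commute)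
       (simp add: mult_of_nat_commute mult.assoc)
  finally show ?case
    by (simp add: algebra_simps power2_eq_square)
qed simp

lemma S_w_power_u: "S_w ^ i * S_u = (S_u * S_w ^ i - of_nat i * (S_w ^ i * S_v) :: 'k::field alg_S)"
proof (induction i)
  case (Suc i)
  have vw: "S_v * S_w ^ n = S_w ^ n * (S_v :: 'k alg_S)" for n
    by (metis S_relations(3) power_commuting_commutes)
  have "S_w ^ Suc i * S_u = S_w * (S_u * S_w ^ i - of_nat i * (S_w ^ i * S_v) :: 'k alg_S)"
    using Suc by (simp add: mult.assoc)
  also have "\<dots> = (S_u * S_w - S_w * S_v) * S_w ^ i - of_nat i * (S_w ^ Suc i * S_v)"
    using S_relations(2,3)[where 'k='k]
    by (simp add: algebra_simps flip: mult_of_nat_commute)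
       (simp add: mult_of_nat_commute mult.assoc)
  finally show ?case
    by (simp add: algebra_simps vw)
qed simp

lemma of_nat_mult_left_commute: "x * (of_nat n * y) = of_nat n * (x * (y :: 'a::ring_1))"
  by (metis mult.assoc mult_of_nat_commute)

text \<open>Since w u = u w - w v and v u = u v - v^2, each of the i + j letters that u passes on
  its way to the left contributes one term with an additional v.\<close>

lemma S_monomial_right:
  "S_monomial (k, i, j) * S_u =
     (S_monomial (Suc k, i, j) - of_nat (i + j) * S_monomial (k, i, Suc j) :: 'k::field alg_S)"
  "S_monomial (k, i, j) * S_v = (S_monomial (k, i, Suc j) :: 'k alg_S)"
  "S_monomial (k, i, j) * S_w = (S_monomial (k, Suc i, j) :: 'k alg_S)"
proof -
  have "S_w ^ i * S_v ^ j * S_u = (S_w ^ i * S_u) * S_v ^ j - of_nat j * (S_w ^ i * S_v ^ Suc j :: 'k alg_S)"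
    by (simp add: S_v_power_u mult.assoc right_diff_distrib mult_of_nat_commute)
  also have "\<dots> = S_u * (S_w ^ i * S_v ^ j) - of_nat (i + j) * (S_w ^ i * S_v ^ Suc j)"
    by (simp add: S_w_power_u algebra_simps)
  finally have *: "S_w ^ i * S_v ^ j * S_u =
    (S_u * (S_w ^ i * S_v ^ j) - of_nat (i + j) * (S_w ^ i * S_v ^ Suc j) :: 'k alg_S)" .
  have "S_monomial (k, i, j) * S_u = S_u ^ k * (S_w ^ i * S_v ^ j * S_u :: 'k alg_S)"
    by (simp add: S_monomial_def mult.assoc)
  also have "\<dots> = S_u ^ k * S_u * (S_w ^ i * S_v ^ j) - of_nat (i + j) * (S_u ^ k * (S_w ^ i * S_v ^ Suc j))"
    unfolding * right_diff_distrib of_nat_mult_left_commute by (simp only: mult.assoc)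
  finally show "S_monomial (k, i, j) * S_u =
     (S_monomial (Suc k, i, j) - of_nat (i + j) * S_monomial (k, i, Suc j) :: 'k::field alg_S)"
    by (simp add: S_monomial_def mult.assoc power_commutes)
  show "S_monomial (k, i, j) * S_v = (S_monomial (k, i, Suc j) :: 'k alg_S)"
    by (simp add: S_monomial_def mult.assoc power_commutes)
  show "S_monomial (k, i, j) * S_w = (S_monomial (k, Suc i, j) :: 'k alg_S)"
    by (simp add: S_monomial_def mult.assoc S_v_power_w)
       (metis mult.assoc power_commutes)
qed

lemma S_scale_of_nat: "of_nat n * y = S_scale (of_nat n) (y :: 'k::field alg_S)"
  by (induction n) (simp_all add: S_space.scale_left_distrib distrib_right)

lemma S_comb_mult_gen:
  assumes "g \<in> {S_u, S_v, S_w :: 'k::field alg_S}"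
  shows "\<exists>d. S_comb c * g = S_comb d"
proof (induction c rule: poly_mapping_add_induct)
  case zero
  show ?case by (intro exI[of _ 0]) (simp add: S_comb_def)
next
  case (single m a)
  obtain k i j where [simp]: "m = (k, i, j)" by (cases m)
  consider "g = S_u" | "g = S_v" | "g = S_w" using assms by blast
  then show ?case
  proof cases
    case 1
    have "S_comb (Poly_Mapping.single m a) * g =
      S_scale a (S_monomial (Suc k, i, j)) + S_scale (- a * of_nat (i + j)) (S_monomial (k, i, Suc j))"
      unfolding S_comb_single S_scale_mult 1
      by (simp only: \<open>m = (k, i, j)\<close> S_monomial_right S_scale_of_nat S_space.scale_right_diff_distrib
          S_space.scale_scale S_space.scale_minus_left minus_mult_left[symmetric]
          add_uminus_conv_diff)
    also have "\<dots> = S_comb (Poly_Mapping.single (Suc k, i, j) a +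
        Poly_Mapping.single (k, i, Suc j) (- a * of_nat (i + j)))"
      by (simp only: S_comb_add S_comb_single)
    finally show ?thesis by blast
  next
    case 2
    then show ?thesis
      by (intro exI[of _ "Poly_Mapping.single (k, i, Suc j) a"])
         (simp add: S_comb_single S_scale_mult S_monomial_right)
  next
    case 3
    then show ?thesis
      by (intro exI[of _ "Poly_Mapping.single (k, Suc i, j) a"])
         (simp add: S_comb_single S_scale_mult S_monomial_right)
  qed
next
  case (add f g)
  then show ?case by (metis S_comb_add distrib_right)
qed

text \<open>The span of the ordered monomials contains 1 and is closed under right multiplication by
  generators, so words are built up by appending letters on the right.\<close>

lemma S_comb_surj: "\<exists>c. y = S_comb c"
proof -
  have "\<exists>p. y = abs_alg_S p" by (induct y rule: alg_S.abs_induct) blast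
  then obtain p where y: "y = abs_alg_S p" by blast
  have "\<exists>c. abs_alg_S p = S_comb c"
  proof (induction p rule: poly_mapping_add_induct)
    case zero
    show ?case by (intro exI[of _ 0]) (simp add: S_comb_def zero_alg_S.abs_eq)
  next
    case (single m a)
    obtain xs where [simp]: "m = Letters xs" by (cases m)
    show ?case
      unfolding \<open>m = Letters xs\<close>
    proof (induction xs rule: rev_induct)
      case Nil
      have "abs_alg_S (Poly_Mapping.single (Letters []) a) = S_scale a 1"
        by (simp add: one_alg_S.abs_eq S_scale.abs_eq fscale_def zero_free_monoid_def)
      also have "1 = S_monomial (0, 0, 0)" by (simp add: S_monomial_def)
      finally show ?case unfolding S_comb_single[symmetric] by blast
    next
      case (snoc x xs)
      have "Poly_Mapping.single (Letters (xs @ [x])) a =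
          Poly_Mapping.single (Letters xs) a * gen x"
        by (simp add: gen_def mult_single)
      then have "abs_alg_S (Poly_Mapping.single (Letters (xs @ [x])) a) =
          abs_alg_S (Poly_Mapping.single (Letters xs) a) * abs_alg_S (gen x)"
        by (simp add: times_alg_S.abs_eq)
      moreover have "abs_alg_S (gen x) \<in> {S_u, S_v, S_w}"
        by (cases x) (simp_all add: S_u.abs_eq S_v.abs_eq S_w.abs_eq)
      ultimately show ?case using snoc S_comb_mult_gen by metis
    qed
  next
    case (add f g)
    then show ?case by (metis S_comb_add plus_alg_S.abs_eq)
  qed
  then show ?thesis using y by simp
qed

section \<open>Linear independence of the images of the ordered monomials\<close>

fun falling :: "nat \<Rightarrow> 'a::comm_ring_1 poly" where
  "falling 0 = 1"
| "falling (Suc k) = [:0, 1:] * twist (falling k)"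

text \<open>\<open>falling k\<close> is s (s - 1) ... (s - k + 1), the coefficient of (s t)^k. That
  it is monic of degree k provides the triangularity in the degree in s.\<close>

lemma falling_degree: "degree (falling k :: 'a::idom poly) = k \<and> lead_coeff (falling k :: 'a poly) = 1"
proof (induction k)
  case (Suc k)
  then have "degree (falling k :: 'a poly) = k" "coeff (falling k :: 'a poly) k = 1"
    by auto
  then have 1: "degree (twist (falling k) :: 'a poly) = k" "lead_coeff (twist (falling k) :: 'a poly) = 1"
    using lead_coeff_comp[of "[:-1, 1:]" "falling k :: 'a poly"]
    by (simp_all add: twist_poly_def degree_pcompose)
  then have "twist (falling k) \<noteq> (0 :: 'a poly)" by auto
  with 1 show ?case by (simp add: degree_mult_eq lead_coeff_mult)
qed simp

lemma S_embed_monomial: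
  "S_embed (S_monomial (k, i, j)) =
     skew_const (falling k * [:[:0, 1:]:] ^ i) * skew_t ^ (k + i + j)"
proof -
  let ?r = "[:[:0, 1:]:] :: 'a poly poly"
  have u: "(skew_const [:0, 1:] * skew_t) ^ k = skew_const (falling k) * (skew_t :: 'a poly poly skew_poly) ^ k"
    by (induction k)
       (simp_all add: mult.assoc skew_t_const_mult skew_const_mult_assoc skew_const_hom(3))
  have r: "twist (?r ^ n) = ?r ^ n" for n
    by (induction n) (simp_all only: power_0 power_Suc twist_1 twist_mult twist_poly_const)
  have w: "(skew_const ?r * skew_t) ^ i = skew_const (?r ^ i) * skew_t ^ i"
    by (induction i)
       (simp_all only: power_0 power_Suc mult.assoc skew_t_const_mult skew_const_mult_assoc
         skew_const_hom(3) r mult_1)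
  have t: "skew_t ^ k * (skew_const (?r ^ i) * p) = skew_const (?r ^ i) * (skew_t ^ k * p)" for p
    by (simp only: skew_t_power_const[OF r] flip: mult.assoc)
  show ?thesis
    by (simp only: S_monomial_def prod.case S_embed.hom_mult S_embed.hom_power S_embed_gens u w
        mult.assoc power_add skew_const_hom t)
qed

text \<open>In a vanishing combination of the $u^k w^i v^j$, the monomial with \<open>k\<close> maximal is the only
  one that contributes to the coefficient of $s^k r^i t^{k + i + j}$.\<close>

lemma S_embed_comb_eq_0:
  assumes "S_embed (S_comb c) = 0"
  shows "c = (0 :: nat \<times> nat \<times> nat \<Rightarrow>\<^sub>0 'k::field)"
proof (rule ccontr)
  assume "c \<noteq> 0"
  define k where "k = Max (fst ` Poly_Mapping.keys c)"
  have max: "fst m \<le> k" if "m \<in> Poly_Mapping.keys c" for m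
    using that by (simp add: k_def)
  have "k \<in> fst ` Poly_Mapping.keys c"
    unfolding k_def using \<open>c \<noteq> 0\<close> by (intro Max_in) simp_all
  then obtain i j where key: "(k, i, j) \<in> Poly_Mapping.keys c" by auto
  let ?coeff = "\<lambda>p. coeff (coeff (skew_coeff p (k + i + j)) k) i"
  have contrib: "?coeff (S_embed (S_scale a (S_monomial m))) = (if m = (k, i, j) then a else 0)"
    if "m \<in> Poly_Mapping.keys c" for m and a :: 'k
  proof -
    obtain k' i' j' where m: "m = (k', i', j')" by (cases m)
    have pow: "[:[:0, 1::'k:]:] ^ i' = [:monom 1 i':]"
      by (induction i') (simp_all add: one_pCons monom_Suc monom_0)
    have "S_embed (S_scale a (S_monomial m)) =
      skew_const ([:[:a:]:] * (falling k' * [:monom 1 i':])) * skew_t ^ (k' + i' + j')"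
      by (simp only: m S_embed_scale S_const_def S_embed_monomial skew_const_mult_assoc pow)
    then have "?coeff (S_embed (S_scale a (S_monomial m))) =
      (if k + i + j = k' + i' + j' then a * coeff (coeff (falling k') k * monom 1 i') i else 0)"
      by (simp add: skew_coeff_monomial mult.commute)
    \<comment> \<open>Maximality leaves k' <= k, and for k' < k there is no term in s^k. Once k' =
      k, the exponent of r gives i' = i, and then the exponent of t gives j' = j.\<close>
    moreover have "coeff (falling k' :: 'k poly poly) k = (if k' = k then 1 else 0)"
      using max[OF that] falling_degree[of k', where 'a="'k poly"] by (auto simp: m coeff_eq_0)
    ultimately show ?thesis by (auto simp: m)
  qed
  have "0 = ?coeff (S_embed (S_comb c))"
    by (simp add: assms zero_skew_poly.rep_eq)
  also have "\<dots> = (\<Sum>m\<in>Poly_Mapping.keys c.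
      ?coeff (S_embed (S_scale (Poly_Mapping.lookup c m) (S_monomial m))))"
  proof -
    have "?coeff (sum f A) = (\<Sum>m\<in>A. ?coeff (f m))" for f :: "nat \<times> nat \<times> nat \<Rightarrow> 'k poly poly skew_poly" and A
      by (induction A rule: infinite_finite_induct)
         (simp_all add: zero_skew_poly.rep_eq plus_skew_poly.rep_eq)
    then show ?thesis by (simp add: S_comb_def psum_def S_embed.hom_sum)
  qed
  also have "\<dots> = Poly_Mapping.lookup c (k, i, j)"
    using key by (simp add: contrib sum.delta cong: sum.cong)
  finally show False using key by (simp add: in_keys_iff)
qed

lemma S_embed_eq_0_iff: "S_embed y = 0 \<longleftrightarrow> y = 0"
proof
  assume "S_embed y = 0"
  moreover obtain c where c: "y = S_comb c" using S_comb_surj by blast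
  ultimately have "c = 0" using S_embed_comb_eq_0 by blast
  then show "y = 0" by (simp add: c S_comb_def)
qed (simp add: S_embed.hom_0)


section \<open>Homomorphisms out of S and R\<close>

interpretation R_space: vector_space R_scale
  by (rule vector_space_R_scale)

lemma R_scale_mult: "R_scale c x * y = R_scale c (x * y)" "x * R_scale c y = R_scale c (x * y)"
  by (transfer; simp add: fscale_mult ideal_cong_refl)+

lemma R_relation: "R_u * R_v - R_v * R_u = (R_v ^ 2 :: 'k::field alg_R)"
proof -
  have "ideal_cong relations_R (gen RU * gen RV - gen RV * gen RU) (gen RV * gen RV :: (gen_R, 'k) free_algebra)"
    unfolding ideal_cong_def
    using ideal_gen_gen[of "gen RU * gen RV - gen RV * gen RU - gen RV ^ 2" relations_R 1 1]
    by (simp add: relations_R_def power2_eq_square)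
  then show ?thesis unfolding power2_eq_square by transfer
qed

definition R_const :: "'k::field \<Rightarrow> 'k poly skew_poly" where
  "R_const c = skew_const [:c:]"

interpretation R_const: central_hom "R_const :: 'k::field \<Rightarrow> 'k poly skew_poly"
proof -
  have "unital_hom (R_const :: 'k \<Rightarrow> 'k poly skew_poly)"
    unfolding R_const_def by (intro unital_hom_comp[OF unital_hom_skew_const] unital_hom_pCons)
  then show "central_hom (R_const :: 'k \<Rightarrow> 'k poly skew_poly)"
    by (simp add: central_hom_def central_hom_axioms_def R_const_def skew_const_commute)
qed

definition R_gens :: "gen_R \<Rightarrow> 'k::field poly skew_poly" where
  "R_gens g = (case g of RU \<Rightarrow> skew_const [:0, 1:] * skew_t | RV \<Rightarrow> skew_t)"

lemma relations_R_vanish: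
  fixes g :: "(gen_R, 'k::field) free_algebra"
  assumes "g \<in> relations_R"
  shows "free_eval R_const R_gens g = 0"
proof -
  interpret e: unital_hom "free_eval R_const R_gens :: (gen_R, 'k) free_algebra \<Rightarrow> 'k poly skew_poly"
    by (rule R_const.unital_hom_free_eval)
  have "R_gens RU * R_gens RV - R_gens RV * R_gens RU = (R_gens RV ^ 2 :: 'k poly skew_poly)"
    by (simp add: R_gens_def skew_t_const_mult twist_poly_X mult.assoc power2_eq_square
        unital_hom.hom_diff[OF unital_hom_skew_const] skew_const_hom left_diff_distrib)
  with assms show ?thesis
    unfolding relations_R_def
    by (auto simp: e.hom_diff e.hom_mult e.hom_power R_const.free_eval_gen)
qed

text \<open>Carries the vanishing of \<open>lam a x\<close> into k[s][t], where it is compared with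
  the image of S at r = a.\<close>

lift_definition R_embed :: "'k::field alg_R \<Rightarrow> 'k poly skew_poly"
  is "free_eval R_const R_gens"
  by (rule R_const.free_eval_ideal_cong[OF relations_R_vanish])

interpretation R_embed: unital_hom "R_embed :: 'k::field alg_R \<Rightarrow> 'k poly skew_poly"
  by unfold_locales
     (transfer; simp add: unital_hom.hom_1[OF R_const.unital_hom_free_eval]
        unital_hom.hom_add[OF R_const.unital_hom_free_eval]
        unital_hom.hom_mult[OF R_const.unital_hom_free_eval])+

lemma R_embed_scale: "R_embed (R_scale c y) = R_const c * R_embed y"
  by transfer (rule R_const.free_eval_fscale)

lemma R_embed_gens:
  "R_embed R_u = skew_const [:0, 1:] * skew_t"
  "R_embed R_v = skew_t"
  by (transfer; simp add: R_const.free_eval_gen R_gens_def)+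

interpretation R_scalar: central_hom "\<lambda>c. R_scale c (1 :: 'k::field alg_R)"
  by unfold_locales (simp_all add: R_space.scale_left_distrib R_scale_mult)

text \<open>Putting w = a v turns the second relation of S into a times the relation of R. The
  resulting map makes \<open>lam a\<close> factor through \<open>phi\<close>, so that
  \<open>ker phi\<close> lies in every \<open>ker (lam a)\<close>.\<close>

definition S_to_R_gens :: "'k::field \<Rightarrow> gen_S \<Rightarrow> 'k alg_R" where
  "S_to_R_gens a g = (case g of SU \<Rightarrow> R_u | SV \<Rightarrow> R_v | SW \<Rightarrow> R_scale a R_v)"

lemma relations_S_vanish_R:
  fixes g :: "(gen_S, 'k::field) free_algebra"
  assumes "g \<in> relations_S"
  shows "free_eval (\<lambda>c. R_scale c 1) (S_to_R_gens a) g = 0"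
proof -
  interpret e: unital_hom "free_eval (\<lambda>c. R_scale c 1) (S_to_R_gens a) :: (gen_S, 'k) free_algebra \<Rightarrow> 'k alg_R"
    by (rule R_scalar.unital_hom_free_eval)
  have "R_scale a (R_u * R_v) - R_scale a (R_v * R_u) = R_scale a (R_v * R_v)"
    using R_relation[where 'k='k]
    by (simp add: power2_eq_square flip: R_space.scale_right_diff_distrib)
  with assms R_relation[where 'k='k] show ?thesis
    unfolding relations_S_def
    by (auto simp: e.hom_diff e.hom_mult e.hom_power R_scalar.free_eval_gen S_to_R_gens_def R_scale_mult)
qed

lift_definition S_to_R :: "'k::field \<Rightarrow> 'k alg_S \<Rightarrow> 'k alg_R"
  is "\<lambda>a. free_eval (\<lambda>c. R_scale c 1) (S_to_R_gens a)"
  by (rule R_scalar.free_eval_ideal_cong[OF relations_S_vanish_R])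

lemma unital_hom_S_to_R: "unital_hom (S_to_R a)"
  by unfold_locales
     (transfer; simp add: unital_hom.hom_1[OF R_scalar.unital_hom_free_eval]
        unital_hom.hom_add[OF R_scalar.unital_hom_free_eval]
        unital_hom.hom_mult[OF R_scalar.unital_hom_free_eval])+

lemma S_to_R_scale: "S_to_R a (S_scale c y) = R_scale c 1 * S_to_R a y"
  by transfer (rule R_scalar.free_eval_fscale)

lemma S_to_R_gens:
  "S_to_R a S_u = R_u" "S_to_R a S_v = R_v" "S_to_R a S_w = R_scale a R_v"
  by (transfer; simp add: R_scalar.free_eval_gen S_to_R_gens_def)+


section \<open>Homomorphisms out of the enveloping algebra\<close>

lemma algebra_hom_unital: "algebra_hom s1 s2 h \<Longrightarrow> unital_hom h"
  unfolding algebra_hom_def unital_hom_def by (simp add: Vector_Spaces.linear_iff)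

lemma algebra_hom_scale: "algebra_hom s1 s2 h \<Longrightarrow> h (s1 c x) = s2 c (h x)"
  unfolding algebra_hom_def by (simp add: Vector_Spaces.linear_iff)

lemma UW_eqI:
  "p - q \<in> enveloping_relations witt_scale witt_bracket \<Longrightarrow> abs_UW p = abs_UW q"
  using ideal_gen_gen[of "p - q" "enveloping_relations witt_scale witt_bracket" 1 1]
  by (simp add: UW.abs_eq_iff ideal_cong_def)

lemma UW_incl_add: "UW_incl (x + y) = UW_incl x + UW_incl y"
  unfolding UW_incl_def plus_UW.abs_eq
  by (rule UW_eqI) (auto simp: enveloping_relations_def)

lemma UW_incl_scale: "UW_incl (witt_scale c x) = UW_scale c (UW_incl x)"
  unfolding UW_incl_def UW_scale.abs_eq
  by (rule UW_eqI) (auto simp: enveloping_relations_def)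

lemma UW_incl_bracket: "UW_incl x * UW_incl y - UW_incl y * UW_incl x = UW_incl (witt_bracket x y)"
  unfolding UW_incl_def times_UW.abs_eq minus_UW.abs_eq
  by (rule UW_eqI) (auto simp: enveloping_relations_def)

lemma UW_e_bracket:
  assumes "n \<ge> 1" "m \<ge> 1"
  shows "UW_e n * UW_e m - UW_e m * UW_e n = UW_scale (of_nat m - of_nat n) (UW_e (n + m))"
  using assms by (simp add: UW_e_def UW_incl_bracket witt_bracket_e UW_incl_scale)

text \<open>In characteristic 0 the algebra is generated by $e_1$ and $e_2$, since
  $[e_1, e_n] = (n - 1) e_{n + 1}$.\<close>

lemma UW_hom_eqI:
  fixes g h :: "'k::field_char_0 UW \<Rightarrow> 'b::ring_1"
  assumes g: "unital_hom g" "\<And>c x. g (UW_scale c x) = \<kappa> c * g x"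
    and h: "unital_hom h" "\<And>c x. h (UW_scale c x) = \<kappa> c * h x"
    and 1: "g (UW_e 1) = h (UW_e 1)" and 2: "g (UW_e 2) = h (UW_e 2)"
  shows "g x = h x"
proof -
  interpret g: unital_hom g by fact
  interpret h: unital_hom h by fact
  interpret U: vector_space UW_scale by (rule vector_space_UW_scale)
  \<comment> \<open>The induction starts at 2: the factor n - 1 vanishes at n = 1, so the value on
    e_2 has to be given separately.\<close>
  have e: "g (UW_e n) = h (UW_e n)" if "n \<ge> 2" for n
    using that
  proof (induction n rule: dec_induct)
    case base
    show ?case by (rule 2)
  next
    case (step n)
    have "of_nat n - 1 \<noteq> (0::'k)" using step(1) by (simp add: of_nat_eq_1_iff)
    then have "UW_e (Suc n) = UW_scale (inverse (of_nat n - 1))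
        (UW_e 1 * UW_e n - UW_e n * UW_e 1 :: 'k UW)"
      using step(1) UW_e_bracket[of 1 n, where 'a='k]
      by (simp del: One_nat_def add: plus_1_eq_Suc)
    then show ?case
      using step 1 by (simp only: g h g.hom_diff g.hom_mult h.hom_diff h.hom_mult)
  qed
  have incl: "g (UW_incl y) = h (UW_incl y)" for y
  proof (induction y rule: poly_mapping_add_induct)
    case zero
    have "UW_incl 0 = (0 :: 'k UW)" using UW_incl_add[of 0 "0::'k witt"] by simp
    then show ?case by (simp add: g.hom_0 h.hom_0)
  next
    case (single i a)
    have "Poly_Mapping.single i a = witt_scale a (witt_e (nat_of_pos i))"
      by (simp add: witt_e_def nat_of_pos_inverse)
    moreover have "nat_of_pos i \<ge> 1" using nat_of_pos[of i] by simp
    then have "g (UW_e (nat_of_pos i)) = h (UW_e (nat_of_pos i))"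
      using e 1 by (cases "nat_of_pos i = 1") auto
    ultimately show ?case by (simp add: UW_incl_scale g h flip: UW_e_def)
  next
    case (add y z)
    then show ?case by (simp add: UW_incl_add g.hom_add h.hom_add)
  qed
  have "g (abs_UW p) = h (abs_UW p)" for p
  proof (induction p rule: poly_mapping_add_induct)
    case zero
    show ?case by (simp add: g.hom_0 h.hom_0 flip: zero_UW.abs_eq)
  next
    case (single m a)
    obtain xs where [simp]: "m = Letters xs" by (cases m)
    show ?case
      unfolding \<open>m = Letters xs\<close>
    proof (induction xs rule: rev_induct)
      case Nil
      have "abs_UW (Poly_Mapping.single (Letters []) a) = UW_scale a 1"
        by (simp add: one_UW.abs_eq UW_scale.abs_eq fscale_def zero_free_monoid_def)
      then show ?case by (simp add: g h g.hom_1 h.hom_1)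
    next
      case (snoc x xs)
      have "Poly_Mapping.single (Letters (xs @ [x])) a =
          Poly_Mapping.single (Letters xs) a * gen x"
        by (simp add: gen_def mult_single)
      then have "abs_UW (Poly_Mapping.single (Letters (xs @ [x])) a) =
          abs_UW (Poly_Mapping.single (Letters xs) a) * UW_incl x"
        by (simp add: times_UW.abs_eq UW_incl_def)
      then show ?case using snoc by (simp add: incl g.hom_mult h.hom_mult)
    qed
  next
    case (add p q)
    then show ?case by (simp add: g.hom_add h.hom_add flip: plus_UW.abs_eq)
  qed
  then show ?thesis by (induct x rule: UW.abs_induct)
qed

section \<open>Coordinates on X\<close>

text \<open>With $x = p^2$, $y = pq$, $z = q^2$ the map tau becomes $[p : q] \mapsto [q : -p - 2q]$, so
  that $q / (p + q)$ is increased by 1 and $p + q$ only changes its sign. Hence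
  $D = (p + q)^2 = x + 2y + z$ is invariant; below $s = 2 - q / (p + q)$, and
  $r = -(w + 4y + 2z) / (6D)$ is the invariant for which $f = (s - r) / (s (s - 1))$.\<close>

definition D_form :: "'k::field mpoly4" where
  "D_form = Var CX + 2 * Var CY + Var CZ"

text \<open>For $D = 1$, the point with coordinates $s = \alpha$ and $r = \beta$.\<close>

definition chart_point :: "'k::field \<Rightarrow> 'k \<Rightarrow> coord \<Rightarrow> 'k" where
  "chart_point \<alpha> \<beta> = (\<lambda>i. case i of
     CW \<Rightarrow> - 6 * \<beta> - 4 * ((\<alpha> - 1) * (2 - \<alpha>)) - 2 * (2 - \<alpha>) ^ 2
   | CX \<Rightarrow> (\<alpha> - 1) ^ 2
   | CY \<Rightarrow> (\<alpha> - 1) * (2 - \<alpha>)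
   | CZ \<Rightarrow> (2 - \<alpha>) ^ 2)"

lemmas peval_simps = peval_add peval_diff peval_uminus peval_mult peval_power peval_numeral
  peval_Var peval_Const peval_1

text \<open>The chart has p = \<alpha> - 1 and q = 2 - \<alpha>, the solution of p + q = 1 and 2p +
  q = \<alpha>; its w is then determined by r = \<beta>.\<close>

lemma peval_chart_D: "peval (\<lambda>x. x) (chart_point \<alpha> \<beta>) D_form = 1"
  by (simp add: D_form_def peval_simps scalar_hom_id chart_point_def power2_eq_square algebra_simps)

lemma peval_chart_quadric: "peval (\<lambda>x. x) (chart_point \<alpha> \<beta>) quadric = 0"
  by (simp add: quadric_def peval_simps scalar_hom_id chart_point_def power2_eq_square algebra_simps)

lemma peval_chart_dvd: "quadric dvd F \<Longrightarrow> peval (\<lambda>x. x) (chart_point \<alpha> \<beta>) F = 0"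
  by (auto elim!: dvdE simp: peval_mult scalar_hom_id peval_chart_quadric)

lemma homogeneous_D_form: "homogeneous 1 D_form"
  unfolding D_form_def by (intro homogeneous_add homogeneous_numeral_mult homogeneous_Var)

lemma D_form_not_dvd: "\<not> quadric dvd (D_form :: 'k::field mpoly4)"
  using peval_chart_dvd[of D_form] peval_chart_D by (metis zero_neq_one)

interpretation clsX: unital_hom "clsX :: 'k::field mpoly4 \<Rightarrow> 'k coordX"
  by unfold_locales simp_all

lemma clsX_numeral: "clsX (numeral n) = numeral n"
  using clsX.hom_of_nat[of "numeral n"] by simp

lemma clsX_D_form: "clsX D_form = clsX (Var CX) + 2 * clsX (Var CY) + clsX (Var CZ)"
  by (simp add: D_form_def clsX_numeral)

lemma clsX_D_form_nz: "clsX D_form \<noteq> (0 :: 'k::field coordX)"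
  by (simp add: clsX_eq_0_iff D_form_not_dvd)

lemma coordX_relation: "clsX (Var CX) * clsX (Var CZ) = clsX (Var CY) * clsX (Var CY)"
proof -
  have "clsX quadric = 0" by (simp add: clsX_eq_0_iff)
  then show ?thesis by (simp add: quadric_def power2_eq_square)
qed

text \<open>This is (2p + q)/(p + q), expanded by p + q so that numerator and denominator become
  linear forms in x, y, z.\<close>

lift_definition s_X :: "'k::field_char_0 funX" is
  "Fract (clsX (2 * Var CX + 3 * Var CY + Var CZ)) (clsX D_form)"
  by (intro homogeneous_fractionI[OF _ homogeneous_D_form D_form_not_dvd]
      homogeneous_add homogeneous_numeral_mult homogeneous_Var)

lemma numeral_D_form_not_dvd:
  "\<not> quadric dvd (numeral n * D_form :: 'k::field_char_0 mpoly4)"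
proof
  assume "quadric dvd (numeral n * D_form :: 'k mpoly4)"
  from peval_chart_dvd[OF this, of 0 0] show False
    by (simp add: peval_simps scalar_hom_id peval_chart_D)
qed

text \<open>The solution of f s (s - 1) = s - r: the left side is (w + 12x + 22y + 8z)/(6D), and s =
  (12x + 18y + 6z)/(6D).\<close>

lift_definition r_X :: "'k::field_char_0 funX" is
  "Fract (clsX (- (Var CW + 4 * Var CY + 2 * Var CZ))) (clsX (6 * D_form))"
  by (intro homogeneous_fractionI[OF _ homogeneous_numeral_mult[OF homogeneous_D_form]
        numeral_D_form_not_dvd]
      homogeneous_uminus homogeneous_add homogeneous_numeral_mult homogeneous_Var)

interpretation pull_cls: unital_hom "pull_cls :: 'k::field coordX \<Rightarrow> 'k coordX"
  by unfold_locales (simp_all add: pull_cls_hom)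

lemma pull_cls_numeral: "pull_cls (numeral n) = numeral n"
  using pull_cls.hom_of_nat[of "numeral n"] by simp

lemma pull_cls_Var:
  "pull_cls (clsX (Var i)) = tau (\<lambda>i. clsX (Var i)) i"
  by (cases i)
     (simp_all add: pull_cls_clsX pull_def peval_Var scalar_hom_Const tau_def clsX_numeral)

lemma pull_cls_D_form: "pull_cls (clsX D_form) = clsX D_form"
  by (simp add: clsX_D_form pull_cls_hom pull_cls_numeral pull_cls_Var tau_def)

lemma six_D_nz: "6 * clsX D_form \<noteq> (0 :: 'k::field_char_0 coordX)"
  using numeral_D_form_not_dvd[of "num.Bit0 (num.Bit1 num.One)", where 'k='k]
  by (simp add: clsX_numeral flip: clsX_eq_0_iff)

lemma twist_s_X: "twist s_X = s_X - (1 :: 'k::field_char_0 funX)"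
  unfolding twist_funX_def
proof transfer
  show "pull_fract (Fract (clsX (2 * Var CX + 3 * Var CY + Var CZ)) (clsX D_form)) =
      Fract (clsX (2 * Var CX + 3 * Var CY + Var CZ)) (clsX D_form) - (1 :: 'k coordX fract)"
    by (simp add: pull_fract_Fract clsX_D_form_nz pull_cls_hom pull_cls_D_form pull_cls_numeral
        pull_cls_Var tau_def clsX_numeral One_fract_def eq_fract)
       (simp add: clsX_D_form algebra_simps)
qed

lemma twist_r_X: "twist r_X = (r_X :: 'k::field_char_0 funX)"
  unfolding twist_funX_def
proof transfer
  show "pull_fract (Fract (clsX (- (Var CW + 4 * Var CY + 2 * Var CZ))) (clsX (6 * D_form))) =
      (Fract (clsX (- (Var CW + 4 * Var CY + 2 * Var CZ))) (clsX (6 * D_form)) :: 'k coordX fract)"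
    using six_D_nz[where 'k='k]
    by (simp add: pull_fract_Fract pull_cls_hom pull_cls.hom_uminus pull_cls.hom_diff
        pull_cls_D_form pull_cls_numeral pull_cls_Var tau_def clsX_numeral algebra_simps)
qed

lemma twist_Const_X: "twist (Const_X c) = Const_X c"
  unfolding twist_funX_def
  by transfer (simp add: pull_fract_Fract pull_cls_hom pull_cls_clsX pull_hom)

text \<open>In terms of p and q, s (s - 1) = p (2p + q)/D = (2x + y)/D, and 2x + y cancels against
  the denominator 6 (2x + y) of f.\<close>

lemma f_X_eq: "f_X * (s_X * (s_X - 1)) = s_X - (r_X :: 'k::field_char_0 funX)"
proof transfer
  let ?c = "\<lambda>i. clsX (Var i) :: 'k coordX"
  let ?N = "2 * ?c CX + 3 * ?c CY + ?c CZ" and ?D = "clsX D_form :: 'k coordX"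
  have den: "12 * ?c CX + 6 * ?c CY \<noteq> 0"
  proof
    assume "12 * ?c CX + 6 * ?c CY = 0"
    then have "quadric dvd (12 * Var CX + 6 * Var CY :: 'k mpoly4)"
      by (simp add: clsX_numeral flip: clsX_eq_0_iff)
    \<comment> \<open>This point has p = 1 and q = 0, and the form takes the value 12 there.\<close>
    from peval_chart_dvd[OF this, of 2 0] show False
      by (simp add: peval_simps scalar_hom_id chart_point_def)
  qed
  \<comment> \<open>On X the factors are 2x + 3y + z = (2p + q)(p + q), x + y = p (p + q) and 2x + y
    = p (2p + q); as polynomials the two products differ by a multiple of the quadric.\<close>
  have "?N * (?c CX + ?c CY) - (2 * ?c CX + ?c CY) * ?D = ?c CY * ?c CY - ?c CX * ?c CZ"
    by (simp add: clsX_D_form algebra_simps)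
  then have 1: "?N * (?c CX + ?c CY) = (2 * ?c CX + ?c CY) * ?D"
    by (simp add: coordX_relation)
  have 2: "Fract ?N ?D - 1 = Fract (?c CX + ?c CY) ?D"
    by (simp add: One_fract_def clsX_D_form_nz eq_fract) (simp add: clsX_D_form algebra_simps)
  have "Fract ?N ?D * Fract (?c CX + ?c CY) ?D = Fract (2 * ?c CX + ?c CY) ?D"
    by (simp add: 1 clsX_D_form_nz eq_fract)
  moreover have "Fract (?c CW + 12 * ?c CX + 22 * ?c CY + 8 * ?c CZ) (12 * ?c CX + 6 * ?c CY) *
      Fract (2 * ?c CX + ?c CY) ?D = Fract (?c CW + 12 * ?c CX + 22 * ?c CY + 8 * ?c CZ) (6 * ?D)"
    using den six_D_nz[where 'k='k] clsX_D_form_nz[where 'k='k]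
    by (simp add: eq_fract)
  moreover have "Fract ?N ?D - Fract (- (?c CW + 4 * ?c CY + 2 * ?c CZ)) (6 * ?D) =
      Fract (?c CW + 12 * ?c CX + 22 * ?c CY + 8 * ?c CZ) (6 * ?D)"
    using six_D_nz[where 'k='k] clsX_D_form_nz[where 'k='k]
    by (simp add: eq_fract algebra_simps)
  ultimately show "Fract (clsX (Var CW + 12 * Var CX + 22 * Var CY + 8 * Var CZ)) (clsX (12 * Var CX + 6 * Var CY)) *
     (Fract (clsX (2 * Var CX + 3 * Var CY + Var CZ)) (clsX D_form) *
      (Fract (clsX (2 * Var CX + 3 * Var CY + Var CZ)) (clsX D_form) - 1)) =
     Fract (clsX (2 * Var CX + 3 * Var CY + Var CZ)) (clsX D_form) -
     (Fract (clsX (- (Var CW + 4 * Var CY + 2 * Var CZ))) (clsX (6 * D_form)) :: 'k coordX fract)"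
    using 2 by (simp add: clsX_numeral)
qed


section \<open>Polynomials as functions on X\<close>

definition poly_X :: "'k::field_char_0 poly poly \<Rightarrow> 'k funX" where
  "poly_X P = poly (map_poly (\<lambda>q. poly (map_poly Const_X q) r_X) P) s_X"

lemma unital_hom_Const_X: "unital_hom Const_X"
  by unfold_locales (simp_all add: Const_X_hom)

lemma unital_hom_inner: "unital_hom (\<lambda>q. poly (map_poly Const_X q) r_X)"
  by (intro unital_hom_comp[OF unital_hom_poly] unital_hom_map_poly unital_hom_Const_X)

interpretation poly_X: unital_hom "poly_X :: 'k::field_char_0 poly poly \<Rightarrow> 'k funX"
  unfolding poly_X_def
  by (intro unital_hom_comp[OF unital_hom_poly] unital_hom_map_poly unital_hom_inner)

lemmas Const_X_0 = unital_hom.hom_0[OF unital_hom_Const_X]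
  and inner_0 = unital_hom.hom_0[OF unital_hom_inner]

lemma poly_X_const: "poly_X [:[:c:]:] = Const_X c"
  by (simp add: poly_X_def map_poly_pCons Const_X_0 inner_0)

lemma poly_X_pCons: "poly_X (pCons q P) = poly (map_poly Const_X q) r_X + s_X * poly_X P"
  by (simp add: poly_X_def map_poly_pCons inner_0)

lemma poly_X_s: "poly_X [:0, 1:] = s_X"
  by (simp add: poly_X_pCons poly_X.hom_1 flip: one_pCons)

lemma poly_X_r: "poly_X [:[:0, 1:]:] = r_X"
  by (simp add: poly_X_pCons poly_X.hom_0 map_poly_pCons Const_X_0 Const_X_hom)

lemma twist_funX_hom: "unital_hom (twist :: 'k::field funX \<Rightarrow> 'k funX)"
  by unfold_locales (rule twist_1 twist_add twist_mult)+

lemma twist_inner: "twist (poly (map_poly Const_X q) r_X) = poly (map_poly Const_X q) r_X"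
  by (induction q)
     (simp_all add: map_poly_pCons Const_X_0 twist_0 twist_add twist_mult twist_Const_X twist_r_X)

text \<open>Both twists fix what comes from k[r] and lower s by 1.\<close>

lemma poly_X_twist: "poly_X (twist P) = twist (poly_X P)"
  for P :: "'k::field_char_0 poly poly"
proof (induction P)
  case 0
  show ?case by (simp add: twist_0 poly_X.hom_0)
next
  case (pCons q P)
  have "poly_X [:-1, 1:] = s_X - (1 :: 'k funX)"
    by (simp add: poly_X_pCons poly_X.hom_0 map_poly_pCons Const_X_0
        map_poly_1 unital_hom.hom_uminus[OF unital_hom_inner] Const_X_hom)
  moreover have "poly_X [:q:] = poly (map_poly Const_X q) r_X"
    by (simp add: poly_X_pCons poly_X.hom_0)
  ultimately show ?case
    by (simp only: twist_poly_pCons poly_X.hom_add poly_X.hom_mult poly_X_pCons[of q P]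
        twist_add twist_mult twist_inner twist_s_X pCons.IH)
qed

section \<open>Algebraic independence of r and s in k(X)\<close>

definition eval2 :: "'k::comm_ring_1 poly poly \<Rightarrow> 'k \<Rightarrow> 'k \<Rightarrow> 'k" where
  "eval2 P \<alpha> \<beta> = poly (map_poly (\<lambda>q. poly q \<beta>) P) \<alpha>"

text \<open>A substitute for evaluating a rational function at chart points: one representative
  whose denominator is a power of D, which is 1 there. If g = 0, the quadric divides F, so e
  vanishes identically.\<close>

definition restricts_to :: "'k::field funX \<Rightarrow> ('k \<Rightarrow> 'k \<Rightarrow> 'k) \<Rightarrow> bool" where
  "restricts_to g e \<longleftrightarrow> (\<exists>F n. Rep_funX g = Fract (clsX F) (clsX D_form ^ n) \<and>
     (\<forall>\<alpha> \<beta>. peval (\<lambda>x. x) (chart_point \<alpha> \<beta>) F = e \<alpha> \<beta>))"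

lemma restricts_to_add:
  assumes "restricts_to g e" "restricts_to g' e'"
  shows "restricts_to (g + g') (\<lambda>\<alpha> \<beta>. e \<alpha> \<beta> + e' \<alpha> \<beta>)"
proof -
  obtain F n F' n' where F: "Rep_funX g = Fract (clsX F) (clsX D_form ^ n)"
      "\<And>\<alpha> \<beta>. peval (\<lambda>x. x) (chart_point \<alpha> \<beta>) F = e \<alpha> \<beta>"
    and F': "Rep_funX g' = Fract (clsX F') (clsX D_form ^ n')"
      "\<And>\<alpha> \<beta>. peval (\<lambda>x. x) (chart_point \<alpha> \<beta>) F' = e' \<alpha> \<beta>"
    using assms unfolding restricts_to_def by blast
  then show ?thesis
    unfolding restricts_to_def
    by (intro exI[of _ "F * D_form ^ n' + F' * D_form ^ n"] exI[of _ "n + n'"])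
       (simp add: plus_funX.rep_eq clsX_D_form_nz clsX.hom_power power_add
         peval_simps scalar_hom_id peval_chart_D)
qed

lemma restricts_to_mult:
  assumes "restricts_to g e" "restricts_to g' e'"
  shows "restricts_to (g * g') (\<lambda>\<alpha> \<beta>. e \<alpha> \<beta> * e' \<alpha> \<beta>)"
proof -
  obtain F n F' n' where F: "Rep_funX g = Fract (clsX F) (clsX D_form ^ n)"
      "\<And>\<alpha> \<beta>. peval (\<lambda>x. x) (chart_point \<alpha> \<beta>) F = e \<alpha> \<beta>"
    and F': "Rep_funX g' = Fract (clsX F') (clsX D_form ^ n')"
      "\<And>\<alpha> \<beta>. peval (\<lambda>x. x) (chart_point \<alpha> \<beta>) F' = e' \<alpha> \<beta>"
    using assms unfolding restricts_to_def by blast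
  then show ?thesis
    unfolding restricts_to_def
    by (intro exI[of _ "F * F'"] exI[of _ "n + n'"])
       (simp add: times_funX.rep_eq power_add peval_simps scalar_hom_id)
qed

lemma restricts_to_Const_X: "restricts_to (Const_X c) (\<lambda>\<alpha> \<beta>. c)"
  unfolding restricts_to_def
  by (intro exI[of _ "Const c"] exI[of _ 0]) (simp add: Const_X.rep_eq peval_simps scalar_hom_id)

lemma restricts_to_s_X: "restricts_to s_X (\<lambda>\<alpha> \<beta>. \<alpha>)"
  unfolding restricts_to_def
  by (intro exI[of _ "2 * Var CX + 3 * Var CY + Var CZ"] exI[of _ 1])
     (simp add: s_X.rep_eq peval_simps scalar_hom_id chart_point_def power2_eq_square algebra_simps)

lemma restricts_to_r_X: "restricts_to r_X (\<lambda>\<alpha> \<beta>. \<beta> :: 'k::field_char_0)"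
proof -
  \<comment> \<open>The denominator of r is 6D; the 6 has to move into the numerator to leave a
    power of D.\<close>
  have "clsX (Const (1/6)) * 6 = (1 :: 'k coordX)"
  proof -
    have "Const (1/6 :: 'k) * 6 = 1"
      using Const_hom(2)[of "1/6 :: 'k" 6] unital_hom.hom_of_nat[of "Const :: 'k \<Rightarrow> _" 6]
      by (simp add: unital_hom_def Const_hom)
    then have "clsX (Const (1/6 :: 'k) * 6) = clsX 1" by simp
    then show ?thesis by (simp add: clsX_numeral)
  qed
  then have "Fract (clsX (- (Var CW + 4 * Var CY + 2 * Var CZ))) (clsX (6 * D_form)) =
    Fract (clsX (Const (1/6) * (- (Var CW + 4 * Var CY + 2 * Var CZ)))) (clsX D_form ^ 1 :: 'k coordX)"
    using six_D_nz[where 'k='k] clsX_D_form_nz[where 'k='k]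
    by (simp add: eq_fract clsX_numeral)
  then show ?thesis
    unfolding restricts_to_def r_X.rep_eq
    by (intro exI[of _ "Const (1/6) * (- (Var CW + 4 * Var CY + 2 * Var CZ))"] exI[of _ 1] conjI)
       (simp_all add: peval_simps scalar_hom_id chart_point_def)
qed

lemma restricts_to_poly_X: "restricts_to (poly_X P) (eval2 P)"
proof (induction P)
  case 0
  show ?case
    using restricts_to_Const_X[of "0::'a"] by (simp add: poly_X.hom_0 eval2_def[abs_def] Const_X_0)
next
  case (pCons q P)
  have inner: "restricts_to (poly (map_poly Const_X q) r_X) (\<lambda>\<alpha> \<beta>. poly q \<beta>)" for q :: "'a poly"
  proof (induction q)
    case 0
    show ?case using restricts_to_Const_X[of "0::'a"] by (simp add: Const_X_0)
  next
    case (pCons c q)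
    show ?case
      using restricts_to_add[OF restricts_to_Const_X[of c] restricts_to_mult[OF restricts_to_r_X pCons.IH]]
      by (simp add: map_poly_pCons Const_X_0)
  qed
  show ?case
    using restricts_to_add[OF inner[of q] restricts_to_mult[OF restricts_to_s_X pCons.IH]]
    by (simp add: poly_X_pCons eval2_def[abs_def] map_poly_pCons)
qed

text \<open>Here k being infinite enters: a coefficient in k[r] that has all of k as roots is zero.
  This serves both the independence of r and s and the intersection of the kernels of the
  \<open>lam a\<close>.\<close>

lemma poly_eval_inner_eq_0:
  fixes P :: "'k::field_char_0 poly poly"
  assumes "\<And>a. map_poly (\<lambda>q. poly q a) P = 0"
  shows "P = 0"
proof (rule poly_eqI)
  fix n
  have "poly (coeff P n) a = 0" for a
    using arg_cong[OF assms[of a], of "\<lambda>p. coeff p n"] by (simp add: coeff_map_poly)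
  then show "coeff P n = coeff 0 n" using poly_all_0_iff_0[of "coeff P n"] by simp
qed

text \<open>The numerator of a vanishing function is zero on X, in particular at all chart points.
  These realise every pair of values, so P vanishes on all of k^2.\<close>

lemma poly_X_eq_0: "poly_X P = 0 \<Longrightarrow> P = 0"
proof -
  assume "poly_X P = 0"
  moreover obtain F n where F: "Rep_funX (poly_X P) = Fract (clsX F) (clsX D_form ^ n)"
      "\<And>\<alpha> \<beta>. peval (\<lambda>x. x) (chart_point \<alpha> \<beta>) F = eval2 P \<alpha> \<beta>"
    using restricts_to_poly_X[of P] unfolding restricts_to_def by blast
  ultimately have "clsX F = 0"
    by (simp add: zero_funX.rep_eq Zero_fract_def eq_fract clsX_D_form_nz)
  then have "eval2 P \<alpha> \<beta> = 0" for \<alpha> \<beta>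
    using peval_chart_dvd F(2) by (metis clsX_eq_0_iff)
  then show "P = 0"
    unfolding eval2_def using poly_all_0_iff_0 by (intro poly_eval_inner_eq_0) blast
qed

section \<open>The extension of \<open>poly_X\<close> to skew polynomials with t sent to s^{-1}
  t\<close>

definition shift_factor :: "nat \<Rightarrow> 'k::field_char_0 funX" where
  "shift_factor n = (\<Prod>i<n. inverse (s_X - of_nat i))"

text \<open>Since \<open>inverse 0 = 0\<close>, this is what keeps \<open>shift_factor\<close> from
  vanishing; the injectivity of the extension depends on it.\<close>

lemma s_X_neq_of_nat [simp]: "s_X \<noteq> of_nat i"
proof
  assume "s_X = (of_nat i :: 'a funX)"
  then have "poly_X ([:0, 1:] - of_nat i :: 'a poly poly) = 0"
    by (simp add: poly_X.hom_diff poly_X_s poly_X.hom_of_nat)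
  then have "[:0, 1:] - of_nat i = (0 :: 'a poly poly)" by (rule poly_X_eq_0)
  then show False by (simp add: of_nat_poly)
qed

lemma twist_funX_inverse: "twist (inverse g) = inverse (twist (g :: 'k::field funX))"
proof (cases "g = 0")
  case False
  then have "twist g * twist (inverse g) = 1"
    by (simp add: twist_1 flip: twist_mult)
  then show ?thesis by (rule inverse_unique[symmetric])
qed (simp add: twist_0)

text \<open>\<open>shift_factor n\<close> is the coefficient of (s^{-1} t)^n. After m twists its
  factors continue exactly where the product for \<open>shift_factor m\<close> ends, which gives the
  cocycle identity.\<close>

lemma twist_pow_shift_factor:
  "(twist ^^ m) (shift_factor n) = (\<Prod>i<n. inverse (s_X - of_nat (m + i)))"
proof (induction m)
  case (Suc m)
  interpret t: unital_hom "twist :: 'a funX \<Rightarrow> 'a funX" by (rule twist_funX_hom)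
  have "twist (prod h A) = (\<Prod>i\<in>A. twist (h i))" for h :: "nat \<Rightarrow> 'a funX" and A
    by (induction A rule: infinite_finite_induct) (simp_all add: twist_1 twist_mult)
  then show ?case
    using Suc by (simp add: twist_funX_inverse t.hom_diff t.hom_add t.hom_1 t.hom_of_nat twist_s_X algebra_simps)
qed (simp add: shift_factor_def)

interpretation skew_X: skew_hom "poly_X :: 'k::field_char_0 poly poly \<Rightarrow> 'k funX" shift_factor
proof
  show "poly_X (twist P) = twist (poly_X P)" for P :: "'k poly poly" by (rule poly_X_twist)
  show "shift_factor 0 = (1 :: 'k funX)" by (simp add: shift_factor_def)
  show "shift_factor (m + n) = shift_factor m * (twist ^^ m) (shift_factor n :: 'k funX)" for m n
    unfolding twist_pow_shift_factor
    by (induction n) (simp_all add: shift_factor_def mult.assoc)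
qed

lemma skew_X_eq_0: "skew_map poly_X shift_factor p = 0 \<Longrightarrow> p = 0"
proof (rule skew_poly_eqI)
  fix n
  assume "skew_map poly_X shift_factor p = 0"
  then have "poly_X (skew_coeff p n) * shift_factor n = 0"
    by (metis skew_X.skew_coeff_map zero_skew_poly.rep_eq)
  moreover have "shift_factor n \<noteq> (0 :: 'a funX)"
    by (simp add: shift_factor_def)
  ultimately show "skew_coeff p n = skew_coeff 0 n"
    using poly_X_eq_0 by (simp add: zero_skew_poly.rep_eq)
qed

section \<open>Specialisation at r = a and comparison of the kernels\<close>

lemma skew_eval: "skew_hom (map_poly (\<lambda>q. poly q a)) (\<lambda>_. 1 :: 'k::field poly)"
proof -
  interpret unital_hom "map_poly (\<lambda>q. poly q a) :: 'k poly poly \<Rightarrow> 'k poly"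
    by (intro unital_hom_map_poly unital_hom_poly)
  show ?thesis
    by unfold_locales (simp_all add: twist_pow map_poly_twist unital_hom_poly)
qed

theorem theorem0p10:
  fixes rho :: "'k::field_char_0 UW \<Rightarrow> 'k funX skew_poly"
    and phi :: "'k UW \<Rightarrow> 'k alg_S"
    and lam :: "'k \<Rightarrow> 'k UW \<Rightarrow> 'k alg_R"
  assumes rho: "algebra_hom UW_scale skewX_scale rho"
      "rho (UW_e 1) = skew_t"
      "rho (UW_e 2) = skew_const f_X * skew_t ^ 2"
    and phi: "algebra_hom UW_scale S_scale phi"
      "\<And>n. n \<ge> 1 \<Longrightarrow> phi (UW_e n) = (S_u - S_scale (of_nat (n - 1)) S_w) * S_v ^ (n - 1)"
    and lam: "\<And>a. algebra_hom UW_scale R_scale (lam a)"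
      "\<And>a n. n \<ge> 1 \<Longrightarrow>
         lam a (UW_e n) = (R_u - R_scale (of_nat (n - 1) * a) R_v) * R_v ^ (n - 1)"
  shows "ker rho = ker phi \<and> ker phi = (\<Inter>a. ker (lam a))"
proof -
  note rho_u = algebra_hom_unital[OF rho(1)] and rho_s = algebra_hom_scale[OF rho(1)]
    and phi_u = algebra_hom_unital[OF phi(1)] and phi_s = algebra_hom_scale[OF phi(1)]
    and lam_u = algebra_hom_unital[OF lam(1)] and lam_s = algebra_hom_scale[OF lam(1)]
  let ?\<Theta> = "skew_map poly_X shift_factor :: 'k poly poly skew_poly \<Rightarrow> 'k funX skew_poly"
  interpret \<Theta>: unital_hom ?\<Theta> by (rule skew_X.unital_hom_skew_map)
  have phi1: "phi (UW_e 1) = S_u" and phi2: "phi (UW_e 2) = (S_u - S_w) * S_v"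
    using phi(2)[of 1] phi(2)[of 2] by simp_all
  have lam1: "lam a (UW_e 1) = R_u" and lam2: "lam a (UW_e 2) = (R_u - R_scale a R_v) * R_v" for a
    using lam(2)[of 1] lam(2)[of 2] by simp_all
  have embed2: "S_embed (phi (UW_e 2)) = skew_const ([:0, 1:] - [:[:0, 1:]:]) * skew_t ^ 2"
    by (simp add: phi2 S_embed.hom_mult S_embed.hom_diff S_embed_gens power2_eq_square mult.assoc
        unital_hom.hom_diff[OF unital_hom_skew_const] left_diff_distrib del: diff_pCons)

  have rho_eq: "?\<Theta> (S_embed (phi x)) = rho x" for x
  proof (rule UW_hom_eqI[where \<kappa> = "\<lambda>c. skew_const (Const_X c)"])
    show "unital_hom (\<lambda>x. ?\<Theta> (S_embed (phi x)))"
      by (intro unital_hom_comp[OF \<Theta>.unital_hom_axioms] unital_hom_comp[OF S_embed.unital_hom_axioms] phi_u)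
    show "?\<Theta> (S_embed (phi (UW_scale c x))) = skew_const (Const_X c) * ?\<Theta> (S_embed (phi x))" for c x
      by (simp add: phi_s S_embed_scale \<Theta>.hom_mult S_const_def skew_X.skew_map_const poly_X_const)
    show "rho (UW_scale c x) = skew_const (Const_X c) * rho x" for c x
      by (simp add: rho_s skewX_scale_def)
    show "unital_hom rho" by (rule rho_u)
    have "s_X \<noteq> (0 :: 'k funX)" "s_X - 1 \<noteq> (0 :: 'k funX)"
      using s_X_neq_of_nat[of 0, where 'a='k] s_X_neq_of_nat[of 1, where 'a='k] by simp_all
    note nz = this
    \<comment> \<open>The coefficient s of the image of u cancels against the s^{-1} in the image of
      t.\<close>
    have "?\<Theta> (S_embed (phi (UW_e 1))) = skew_const (s_X * inverse s_X) * skew_t"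
      by (simp only: phi1 S_embed_gens \<Theta>.hom_mult skew_X.skew_map_const skew_X.skew_map_t poly_X_s
          skew_const_mult_assoc) (simp add: shift_factor_def)
    then show "?\<Theta> (S_embed (phi (UW_e 1))) = rho (UW_e 1)"
      by (simp only: rho right_inverse[OF nz(1)] skew_const_hom(3) mult_1)
    have "?\<Theta> (S_embed (phi (UW_e 2))) = skew_const ((s_X - r_X) * shift_factor 2) * skew_t ^ 2"
      by (rule skew_poly_eqI)
         (simp add: embed2 skew_X.skew_coeff_map skew_coeff_monomial poly_X.hom_0 poly_X.hom_diff
           poly_X_s poly_X_r del: diff_pCons)
    also have "(s_X - r_X) * shift_factor 2 = (f_X :: 'k funX)"
    proof -
      have "shift_factor 2 = inverse (s_X * (s_X - 1) :: 'k funX)"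
        by (simp add: shift_factor_def numeral_2_eq_2)
      moreover have "s_X * (s_X - 1) \<noteq> (0 :: 'k funX)" using nz by simp
      ultimately show ?thesis
        by (metis f_X_eq mult.assoc mult_1_right right_inverse)
    qed
    finally show "?\<Theta> (S_embed (phi (UW_e 2))) = rho (UW_e 2)" by (simp add: rho)
  qed
  have "rho x = 0 \<longleftrightarrow> phi x = 0" for x
    using skew_X_eq_0 S_embed_eq_0_iff \<Theta>.hom_0 rho_eq by metis
  then have 1: "ker rho = ker phi" by (simp add: ker_def)

  have lam_eq: "lam a x = S_to_R a (phi x)" for a x
  proof (rule UW_hom_eqI[where \<kappa> = "\<lambda>c. R_scale c 1"])
    show "unital_hom (lam a)" by (rule lam_u)
    show "unital_hom (\<lambda>x. S_to_R a (phi x))"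
      by (intro unital_hom_comp[OF unital_hom_S_to_R] phi_u)
    show "lam a (UW_scale c x) = R_scale c 1 * lam a x" for c x
      by (simp add: lam_s R_scale_mult)
    show "S_to_R a (phi (UW_scale c x)) = R_scale c 1 * S_to_R a (phi x)" for c x
      by (simp add: phi_s S_to_R_scale)
    show "lam a (UW_e 1) = S_to_R a (phi (UW_e 1))"
      by (simp only: lam1 phi1 S_to_R_gens)
    show "lam a (UW_e 2) = S_to_R a (phi (UW_e 2))"
      by (simp add: lam2 phi2 S_to_R_gens unital_hom.hom_mult[OF unital_hom_S_to_R]
          unital_hom.hom_diff[OF unital_hom_S_to_R])
  qed

  \<comment> \<open>Two homomorphisms into k[s][t] that agree on e_1 and e_2: setting r = a after
    embedding S, and \<open>R_embed\<close> after \<open>lam a\<close>.\<close>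
  have eval_eq: "skew_map (map_poly (\<lambda>q. poly q a)) (\<lambda>_. 1) (S_embed (phi x)) = R_embed (lam a x)" for a x
  proof -
    interpret e: skew_hom "map_poly (\<lambda>q. poly q a)" "\<lambda>_. 1 :: 'k poly" by (rule skew_eval)
    let ?E = "skew_map (map_poly (\<lambda>q. poly q a)) (\<lambda>_. 1 :: 'k poly)"
    interpret E: unital_hom ?E by (rule e.unital_hom_skew_map)
    show ?thesis
    proof (rule UW_hom_eqI[where \<kappa> = R_const])
      show "unital_hom (\<lambda>x. ?E (S_embed (phi x)))"
        by (intro unital_hom_comp[OF E.unital_hom_axioms] unital_hom_comp[OF S_embed.unital_hom_axioms] phi_u)
      show "unital_hom (\<lambda>x. R_embed (lam a x))"
        by (intro unital_hom_comp[OF R_embed.unital_hom_axioms] lam_u)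
      show "?E (S_embed (phi (UW_scale c x))) = R_const c * ?E (S_embed (phi x))" for c x
        by (simp add: phi_s S_embed_scale E.hom_mult S_const_def R_const_def e.skew_map_const
            map_poly_pCons)
      show "R_embed (lam a (UW_scale c x)) = R_const c * R_embed (lam a x)" for c x
        by (simp add: lam_s R_embed_scale)
      show "?E (S_embed (phi (UW_e 1))) = R_embed (lam a (UW_e 1))"
        by (simp only: phi1 lam1 S_embed_gens R_embed_gens E.hom_mult e.skew_map_const e.skew_map_t)
           (simp add: map_poly_pCons skew_const_hom)
      show "?E (S_embed (phi (UW_e 2))) = R_embed (lam a (UW_e 2))"
        by (simp only: phi2 lam2 S_embed_gens R_embed_gens E.hom_mult E.hom_diff S_embed.hom_mult
            S_embed.hom_diff R_embed.hom_mult R_embed.hom_diff R_embed_scale R_const_def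
            e.skew_map_const e.skew_map_t)
           (simp add: map_poly_pCons skew_const_hom)
    qed
  qed
  have "phi x = 0" if "\<And>a. lam a x = 0" for x
  proof -
    have "S_embed (phi x) = 0"
    proof (rule skew_poly_eqI)
      fix n
      have "map_poly (\<lambda>q. poly q a) (skew_coeff (S_embed (phi x)) n) = 0" for a
      proof -
        interpret e: skew_hom "map_poly (\<lambda>q. poly q a)" "\<lambda>_. 1 :: 'k poly" by (rule skew_eval)
        show ?thesis
          using arg_cong[OF eval_eq[of a x], of "\<lambda>p. skew_coeff p n"]
          by (simp add: e.skew_coeff_map that R_embed.hom_0 zero_skew_poly.rep_eq)
      qed
      then show "skew_coeff (S_embed (phi x)) n = skew_coeff 0 n"
        by (simp add: poly_eval_inner_eq_0 zero_skew_poly.rep_eq)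
    qed
    then show ?thesis by (simp add: S_embed_eq_0_iff)
  qed
  moreover have "lam a x = 0" if "phi x = 0" for a x
    by (simp add: lam_eq that unital_hom.hom_0[OF unital_hom_S_to_R])
  ultimately have "ker phi = (\<Inter>a. ker (lam a))" by (auto simp: ker_def)
  with 1 show ?thesis by simp
qed

end
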